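(* Let $V, W \subset \mathbb{R}^2$ be two polygons with vertices $\mathbf{v}_1,\dots,\mathbf{v}_n$ and $\mathbf{w}_1,\dots,\mathbf{w}_n$ respectively, each list arranged in counter-clockwise order along the boundary. Let $\phi_1,\dots,\phi_n$ be the harmonic generalized barycentric coordinate (GBC) functions over $V$, and let $\mathbf{F}=(u,v)$ be the harmonic GBC map $$\mathbf{F}(x,y)=\sum_{i=1}^n \phi_i(x,y)\,\mathbf{w}_i,\qquad (x,y)\in V.$$ If $W$ is convex, then $\mathbf{F}$ is a bijection from $V$ to $W$.
   Context: A polygon means a compact region in $\mathbb{R}^2$ (including its boundary) with nonempty interior bounded by a simple closed polygonal curve; it need not be convex unless stated. GBC functions over a polygon $V$ with vertices $\mathbf{v}_1,\dots,\mathbf{v}_n$ are functions $\phi_1,\dots,\phi_n$ on $V$ such that, for all $\mathbf{x}\in V$, $\sum_{i=1}^n\phi_i(\mathbf{x})=1$, $\sum_{i=1}^n\phi_i(\mathbf{x})\mathbf{v}_i=\mathbf{x}$, $\phi_i(\mathbf{x})\ge 0$ for every $i$, and such that each $\phi_i$ is linear on every edge of $V$ with $\phi_i(\mathbf{v}_j)=1$ if $i=j$ and $0$ if $i\neq j$. They are called harmonic GBC functions if in addition each $\phi_i$ is continuous on $V$ and harmonic ($\Delta\phi_i=0$) in the interior of $V$. *)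

theory Defs
  imports "HOL-Complex_Analysis.Complex_Analysis"
begin

text \<open>The plane is modelled by the type \<^typ>\<open>complex\<close>, a Euclidean space with basis \<open>{1, \<i>}\<close>.\<close>

section \<open>Polygons\<close>

text \<open>The values on the empty and one-element lists are junk: the resulting constant paths are
  not simple.\<close>

fun polygonal_path :: "complex list \<Rightarrow> real \<Rightarrow> complex" where
  "polygonal_path [] = linepath 0 0"
| "polygonal_path [a] = linepath a a"
| "polygonal_path [a, b] = linepath a b"
| "polygonal_path (a # b # c # xs) = linepath a b +++ polygonal_path (b # c # xs)"

definition boundary_curve :: "complex list \<Rightarrow> real \<Rightarrow> complex" where
  "boundary_curve vs = polygonal_path (vs @ [hd vs])"

text \<open>Simplicity of the boundary curve makes the vertices distinct; consecutive collinear edges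
  (vertices with a straight angle) are allowed.\<close>

definition polygon :: "complex set \<Rightarrow> complex list \<Rightarrow> bool" where
  "polygon V vs \<longleftrightarrow>
     3 \<le> length vs \<and> simple_path (boundary_curve vs) \<and>
     compact V \<and> interior V \<noteq> {} \<and> frontier V = path_image (boundary_curve vs)"

definition counter_clockwise :: "complex set \<Rightarrow> complex list \<Rightarrow> bool" where
  "counter_clockwise V vs \<longleftrightarrow> (\<forall>z\<in>interior V. winding_number (boundary_curve vs) z = 1)"

section \<open>Harmonic functions\<close>

definition partial_deriv :: "'a::euclidean_space \<Rightarrow> ('a \<Rightarrow> real) \<Rightarrow> 'a \<Rightarrow> real" where
  "partial_deriv b f x = deriv (\<lambda>t. f (x + t *\<^sub>R b)) 0"

definition laplacian :: "('a::euclidean_space \<Rightarrow> real) \<Rightarrow> 'a \<Rightarrow> real" where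
  "laplacian f x = (\<Sum>b\<in>Basis. partial_deriv b (partial_deriv b f) x)"

definition C2_on :: "('a::euclidean_space \<Rightarrow> real) \<Rightarrow> 'a set \<Rightarrow> bool" where
  "C2_on f S \<longleftrightarrow>
     f differentiable_on S \<and>
     (\<forall>b\<in>Basis. partial_deriv b f differentiable_on S) \<and>
     (\<forall>b\<in>Basis. \<forall>c\<in>Basis. continuous_on S (partial_deriv c (partial_deriv b f)))"

definition harmonic_on :: "('a::euclidean_space \<Rightarrow> real) \<Rightarrow> 'a set \<Rightarrow> bool" where
  "harmonic_on f S \<longleftrightarrow> open S \<and> C2_on f S \<and> (\<forall>x\<in>S. laplacian f x = 0)"

section \<open>Generalized barycentric coordinates\<close>

text \<open>Vertices are indexed from 0, and edge \<open>j\<close> joins \<open>vs ! j\<close> to its cyclic successor.\<close>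

definition linear_on_segment :: "(complex \<Rightarrow> real) \<Rightarrow> complex \<Rightarrow> complex \<Rightarrow> bool" where
  "linear_on_segment f a b \<longleftrightarrow>
     (\<forall>t\<in>{0..1}. f ((1 - t) *\<^sub>R a + t *\<^sub>R b) = (1 - t) * f a + t * f b)"

definition gbc_functions :: "complex set \<Rightarrow> complex list \<Rightarrow> (nat \<Rightarrow> complex \<Rightarrow> real) \<Rightarrow> bool" where
  "gbc_functions V vs \<phi> \<longleftrightarrow>
     (\<forall>x\<in>V. (\<Sum>i<length vs. \<phi> i x) = 1 \<and>
            (\<Sum>i<length vs. \<phi> i x *\<^sub>R vs ! i) = x \<and>
            (\<forall>i<length vs. \<phi> i x \<ge> 0)) \<and>
     (\<forall>i<length vs. \<forall>j<length vs.
        linear_on_segment (\<phi> i) (vs ! j) (vs ! (Suc j mod length vs)) \<and>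
        \<phi> i (vs ! j) = (if i = j then 1 else 0))"

definition harmonic_gbc_functions ::
    "complex set \<Rightarrow> complex list \<Rightarrow> (nat \<Rightarrow> complex \<Rightarrow> real) \<Rightarrow> bool" where
  "harmonic_gbc_functions V vs \<phi> \<longleftrightarrow>
     gbc_functions V vs \<phi> \<and>
     (\<forall>i<length vs. continuous_on V (\<phi> i) \<and> harmonic_on (\<phi> i) (interior V))"

definition gbc_map :: "(nat \<Rightarrow> complex \<Rightarrow> real) \<Rightarrow> complex list \<Rightarrow> complex \<Rightarrow> complex" where
  "gbc_map \<phi> ws x = (\<Sum>i<length ws. \<phi> i x *\<^sub>R ws ! i)"

end

theory Submission
  imports Defs
begin

text \<open>
  This is the Rado-Kneser-Choquet theorem for polygons. Let \<open>F\<close> be the map and \<open>h = c \<bullet> F - k\<close> an affine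
  functional of it with \<open>c \<noteq> 0\<close>, which is harmonic. On the boundary \<open>F\<close> is a homeomorphism onto the
  frontier of the convex set \<open>W\<close>, so if \<open>h\<close> takes both signs, the parts of the boundary of \<open>V\<close> where
  \<open>h > 0\<close> and \<open>h < 0\<close> are connected (\<open>connected_frontier_Int_halfspace\<close>). By the maximum principle the sets \<open>{h > 0}\<close> and
  \<open>{h < 0}\<close> in \<open>V\<close> are then connected as well (\<open>connected_positivity_set\<close>). At an interior critical point
  with \<open>h = 0\<close> at least four sectors of alternating sign of \<open>h\<close> would meet
  (\<open>Re_holomorphic_alternating_rays\<close>), and joining the positive ones to each other and the negative
  ones to each other would produce two crossing paths in the plane without a common point
  (\<open>no_crossing_at_origin\<close>). Hence no functional of \<open>F\<close> has an interior critical point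
  (\<open>no_critical_zero\<close>), which says that the Jacobian of \<open>F\<close> does not vanish.

  So \<open>F\<close> is locally injective, thus open, on the interior of \<open>V\<close>. Being a convex combination of the
  vertices of \<open>W\<close>, it maps \<open>V\<close> into \<open>W\<close>, hence interior into interior, and there it is
  proper because it takes the frontier to the frontier. A proper local homeomorphism from a connected
  open set to a convex one is a covering of a simply connected space, hence a bijection
  (\<open>proper_locally_injective_bij_betw_convex\<close>). Together with the bijection of the frontiers this
  proves the theorem.
\<close>

section \<open>Proper local homeomorphisms onto convex sets\<close>

text \<open>By invariance of domain a locally injective continuous map between open subsets of the same
  Euclidean space is a local homeomorphism; properness makes the fibres finite and the sheets
  uniform.\<close>
lemma proper_locally_injective_covering_space:
  fixes p :: "'a::euclidean_space \<Rightarrow> 'a"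
  assumes "open C" "open S" and cont: "continuous_on C p" and im: "p ` C = S"
    and li: "\<And>z. z \<in> C \<Longrightarrow> \<exists>r>0. ball z r \<subseteq> C \<and> inj_on p (ball z r)"
    and proper: "\<And>K. compact K \<Longrightarrow> K \<subseteq> S \<Longrightarrow> compact (C \<inter> p -` K)"
  shows "covering_space C p S"
proof (rule covering_spaceI[OF cont im])
  have openmap: "open (p ` ball z r)" if "ball z r \<subseteq> C" "inj_on p (ball z r)" for z r
    using that cont by (intro invariance_of_domain) (auto intro: continuous_on_subset)
  fix x assume "x \<in> S"
  define Z where "Z = C \<inter> p -` {x}"
  have "Z \<noteq> {}"
    using \<open>x \<in> S\<close> im by (auto simp: Z_def)
  have "compact Z"
    unfolding Z_def using \<open>x \<in> S\<close> by (intro proper) auto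
  obtain r where r: "\<And>z. z \<in> C \<Longrightarrow> r z > 0 \<and> ball z (r z) \<subseteq> C \<and> inj_on p (ball z (r z))"
    using li by metis
  have "finite Z"
  proof -
    have "Z \<subseteq> (\<Union>z\<in>Z. ball z (r z))"
      using r by (auto simp: Z_def)
    then obtain D where D: "D \<subseteq> Z" "finite D" "Z \<subseteq> (\<Union>z\<in>D. ball z (r z))"
      using compactE_image[OF \<open>compact Z\<close>, of Z "\<lambda>z. ball z (r z)"] by auto
    have "z \<in> D" if "z \<in> Z" for z
    proof -
      have "z \<in> (\<Union>d\<in>D. ball d (r d))"
        using D(3) that by (rule subsetD)
      then obtain d where d: "d \<in> D" "z \<in> ball d (r d)"
        by (rule UN_E)
      have "d \<in> C" "p d = p z"
        using D d that by (auto simp: Z_def)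
      moreover from this have "d \<in> ball d (r d)" "inj_on p (ball d (r d))"
        using r[of d] by auto
      ultimately have "d = z"
        using d by (auto simp: inj_on_def)
      then show ?thesis using d by simp
    qed
    then show ?thesis
      using D(2) finite_subset[of Z D] by blast
  qed
  obtain \<rho> where \<rho>: "\<rho> > 0" "\<And>z. z \<in> Z \<Longrightarrow> \<rho> \<le> r z"
    and sep: "\<And>y z. y \<in> Z \<Longrightarrow> z \<in> Z \<Longrightarrow> y \<noteq> z \<Longrightarrow> 2 * \<rho> \<le> dist y z"
  proof -
    define E where "E = r ` Z \<union> (\<lambda>(y, z). dist y z / 2) ` (Z \<times> Z - Id)"
    have "finite E" "E \<noteq> {}"
      using \<open>finite Z\<close> \<open>Z \<noteq> {}\<close> by (auto simp: E_def)
    have "r z > 0" if "z \<in> Z" for z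
      using r[of z] that by (simp add: Z_def)
    then have "\<forall>t\<in>E. t > 0"
      by (auto simp: E_def)
    then have pos: "Min E > 0"
      using \<open>finite E\<close> \<open>E \<noteq> {}\<close> by simp
    have "Min E \<le> r z" if "z \<in> Z" for z
      using \<open>finite E\<close> that by (intro Min_le) (auto simp: E_def)
    moreover have "2 * Min E \<le> dist y z" if "y \<in> Z" "z \<in> Z" "y \<noteq> z" for y z
    proof -
      have "Min E \<le> dist y z / 2"
        using \<open>finite E\<close> that by (intro Min_le) (force simp: E_def)+
      then show ?thesis by simp
    qed
    ultimately show thesis
      using pos that by blast
  qed
  have sub: "ball z \<rho> \<subseteq> C" and inj: "inj_on p (ball z \<rho>)" if "z \<in> Z" for z
  proof -
    have "ball z \<rho> \<subseteq> ball z (r z)" "z \<in> C"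
      using \<rho>(2)[OF that] that by (auto simp: Z_def)
    then show "ball z \<rho> \<subseteq> C" "inj_on p (ball z \<rho>)"
      using r[of z] inj_on_subset by blast+
  qed
  \<comment> \<open>Properness confines the preimage of a small ball about \<open>x\<close> to the balls about the fibre.\<close>
  obtain \<delta> where \<delta>: "\<delta> > 0" "ball x \<delta> \<subseteq> S" "C \<inter> p -` ball x \<delta> \<subseteq> (\<Union>z\<in>Z. ball z \<rho>)"
    "\<And>z. z \<in> Z \<Longrightarrow> ball x \<delta> \<subseteq> p ` ball z \<rho>"
  proof -
    obtain e where e: "e > 0" "cball x e \<subseteq> S"
      using \<open>open S\<close> \<open>x \<in> S\<close> open_contains_cball by blast
    define L where "L = C \<inter> p -` cball x e - (\<Union>z\<in>Z. ball z \<rho>)"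
    have "compact L"
      unfolding L_def using e by (intro compact_diff proper) auto
    moreover have "continuous_on L p"
      using cont by (rule continuous_on_subset) (auto simp: L_def)
    ultimately have "closed (p ` L)"
      by (intro compact_imp_closed compact_continuous_image)
    moreover have centre: "z \<in> ball z \<rho>" for z
      using \<rho>(1) by simp
    then have "x \<notin> p ` L"
      unfolding L_def Z_def by blast
    moreover have "open (\<Inter>z\<in>Z. p ` ball z \<rho>)"
      using \<open>finite Z\<close> openmap sub inj by (intro open_INT) auto
    moreover have "x \<in> (\<Inter>z\<in>Z. p ` ball z \<rho>)"
      using centre unfolding Z_def by blast
    ultimately have "open ((\<Inter>z\<in>Z. p ` ball z \<rho>) - p ` L)" "x \<in> (\<Inter>z\<in>Z. p ` ball z \<rho>) - p ` L"
      by auto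
    then obtain d where d: "d > 0" "ball x d \<subseteq> (\<Inter>z\<in>Z. p ` ball z \<rho>) - p ` L"
      by (rule openE)
    define \<delta> where "\<delta> = min d e"
    have *: "ball x \<delta> \<subseteq> ball x d" "ball x \<delta> \<subseteq> cball x e"
      by (auto simp: \<delta>_def)
    have "C \<inter> p -` ball x \<delta> \<subseteq> (\<Union>z\<in>Z. ball z \<rho>)"
    proof (rule ccontr)
      assume "\<not> ?thesis"
      then obtain z where "z \<in> C" "p z \<in> ball x \<delta>" "z \<notin> (\<Union>z\<in>Z. ball z \<rho>)"
        by blast
      then have "p z \<in> p ` L" "p z \<in> ball x d"
        using * unfolding L_def by blast+
      then show False
        using d by blast
    qed
    then show thesis
      using * d e by (intro that[of \<delta>]) (auto simp: \<delta>_def)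
  qed
  define v where "v = (\<lambda>z. ball z \<rho> \<inter> p -` ball x \<delta>) ` Z"
  have open_sheet: "open (ball z \<rho> \<inter> p -` ball x \<delta>)" if "z \<in> Z" for z
    using sub[OF that] cont by (intro continuous_open_preimage) (auto intro: continuous_on_subset)
  show "\<exists>T. x \<in> T \<and> openin (top_of_set S) T \<and>
          (\<exists>v. \<Union> v = C \<inter> p -` T \<and> (\<forall>u\<in>v. openin (top_of_set C) u) \<and> pairwise disjnt v \<and>
               (\<forall>u\<in>v. \<exists>q. homeomorphism u T p q))"
  proof (intro exI[of _ "ball x \<delta>"] exI[of _ v] conjI ballI)
    show "x \<in> ball x \<delta>" "openin (top_of_set S) (ball x \<delta>)"
      using \<delta> \<open>open S\<close> by (auto simp: openin_open_eq)
    define U where "U = (\<Union>z\<in>Z. ball z \<rho>)"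
    have "U \<subseteq> C" "C \<inter> p -` ball x \<delta> \<subseteq> U"
      using \<delta>(3) UN_least[of Z "\<lambda>z. ball z \<rho>" C] sub by (simp_all add: U_def)
    moreover have "\<Union> v = U \<inter> p -` ball x \<delta>"
      unfolding v_def U_def by (simp add: Int_UN_distrib2)
    ultimately show "\<Union> v = C \<inter> p -` ball x \<delta>"
      by blast
    show "openin (top_of_set C) u" if "u \<in> v" for u
      using that open_sheet sub \<open>open C\<close> by (auto simp: openin_open_eq v_def)
    have "disjnt (ball y \<rho>) (ball z \<rho>)" if "y \<in> Z" "z \<in> Z" "y \<noteq> z" for y z
      unfolding disjnt_def using sep[OF that] by (intro disjoint_ballI) auto
    then show "pairwise disjnt v"
      unfolding v_def pairwise_image by (auto simp: pairwise_def disjnt_iff)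
    fix u assume "u \<in> v"
    then obtain z where z: "z \<in> Z" "u = ball z \<rho> \<inter> p -` ball x \<delta>"
      by (auto simp: v_def)
    have "p ` u = ball x \<delta>"
      using \<delta>(4)[OF z(1)] z(2) by blast
    moreover have "\<exists>q. homeomorphism u (p ` u) p q"
    proof (rule invariance_of_domain_homeomorphism[of u p])
      show "open u" using open_sheet z by simp
      show "continuous_on u p" using cont sub z by (auto intro: continuous_on_subset)
      show "inj_on p u" using inj[OF z(1)] z(2) by (auto simp: inj_on_def)
    qed auto
    ultimately show "\<exists>q. homeomorphism u (ball x \<delta>) p q" by simp
  qed
qed

text \<open>The image is open and, by properness, relatively closed, so the map is onto; as the target is
  simply connected, the covering has a section through each point, which leaves no room for a
  second sheet.\<close>
lemma proper_locally_injective_bij_betw_convex: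
  fixes p :: "'a::euclidean_space \<Rightarrow> 'a"
  assumes "open C" "connected C" "C \<noteq> {}" "open S" "convex S"
    and cont: "continuous_on C p" and im: "p ` C \<subseteq> S"
    and li: "\<And>z. z \<in> C \<Longrightarrow> \<exists>r>0. ball z r \<subseteq> C \<and> inj_on p (ball z r)"
    and proper: "\<And>K. compact K \<Longrightarrow> K \<subseteq> S \<Longrightarrow> compact (C \<inter> p -` K)"
  shows "bij_betw p C S"
proof -
  have "open (p ` C)"
  proof (subst open_subopen, safe)
    fix z assume "z \<in> C"
    then obtain r where r: "r > 0" "ball z r \<subseteq> C" "inj_on p (ball z r)"
      using li by blast
    then have "open (p ` ball z r)"
      using cont by (intro invariance_of_domain) (auto intro: continuous_on_subset)
    then show "\<exists>T. open T \<and> p z \<in> T \<and> T \<subseteq> p ` C"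
      using r by (intro exI[of _ "p ` ball z r"]) auto
  qed
  moreover have "open (S - p ` C)"
  proof (subst open_subopen, safe)
    fix w assume w: "w \<in> S" "w \<notin> p ` C"
    obtain e where e: "e > 0" "cball w e \<subseteq> S"
      using \<open>open S\<close> w open_contains_cball by blast
    define L where "L = C \<inter> p -` cball w e"
    have "compact L"
      unfolding L_def using e by (intro proper) auto
    moreover have "continuous_on L p"
      using cont by (rule continuous_on_subset) (auto simp: L_def)
    ultimately have "closed (p ` L)"
      by (intro compact_imp_closed compact_continuous_image)
    then have "open (ball w e - p ` L)"
      by (intro open_Diff) auto
    moreover have "w \<in> ball w e - p ` L"
      using w e by (auto simp: L_def)
    moreover have "ball w e - p ` L \<subseteq> S - p ` C"
      using e(2) unfolding L_def by (fastforce simp: subset_iff)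
    ultimately show "\<exists>T. open T \<and> w \<in> T \<and> T \<subseteq> S - p ` C"
      by blast
  qed
  ultimately have surj: "p ` C = S"
    using convex_connected[OF \<open>convex S\<close>] im \<open>C \<noteq> {}\<close> connectedD[of S "p ` C" "S - p ` C"] by blast
  have cov: "covering_space C p S"
    using assms surj by (intro proper_locally_injective_covering_space) auto
  have "z = y" if "z \<in> C" "y \<in> C" "p z = p y" for y z
  proof -
    \<comment> \<open>A global section through \<open>z\<close>; its image is open and closed in \<open>C\<close>.\<close>
    obtain s where s: "continuous_on S s" "s \<in> S \<rightarrow> C" "s (p z) = z" "\<And>w. w \<in> S \<Longrightarrow> p (s w) = w"
    proof (rule covering_space_lift_strong[OF cov \<open>z \<in> C\<close>, of "p z" S id])
      show "p z \<in> S" using im \<open>z \<in> C\<close> by blast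
      show "simply_connected S"
        using \<open>convex S\<close> by (rule convex_imp_simply_connected)
      show "locally path_connected S"
        using \<open>convex S\<close> by (rule convex_imp_locally_path_connected)
    qed auto
    have "open (s ` S)"
      using s \<open>open S\<close> by (intro invariance_of_domain) (auto intro: inj_on_inverseI[of _ p])
    moreover have "openin (top_of_set C) (C - s ` S)"
    proof -
      have eq: "s ` S = {x \<in> C. s (p x) = x}"
        using s im by (force simp: image_iff)
      have "continuous_on C (\<lambda>x. s (p x))"
        using s cont im by (intro continuous_on_compose2[of S s C p]) auto
      then have "closedin (top_of_set C) {x \<in> C. s (p x) - x = 0}"
        by (intro continuous_closedin_preimage_constant continuous_intros)
      then have "closedin (top_of_set C) (s ` S)"
        by (simp add: eq)
      then show ?thesis by (simp add: closedin_def)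
    qed
    then have "open (C - s ` S)"
      using \<open>open C\<close> by (simp add: openin_open_eq)
    moreover have "z \<in> s ` S"
      using s im \<open>z \<in> C\<close> by force
    ultimately have "C \<subseteq> s ` S"
      using \<open>connected C\<close> \<open>z \<in> C\<close> connectedD[of C "s ` S" "C - s ` S"] by blast
    then obtain w where "w \<in> S" "y = s w"
      using \<open>y \<in> C\<close> by blast
    then have "w = p z"
      using s(4)[OF \<open>w \<in> S\<close>] that by metis
    then show ?thesis
      using s(3) \<open>y = s w\<close> by simp
  qed
  then show ?thesis
    using surj by (auto simp: bij_betw_def inj_on_def)
qed

section \<open>Harmonic functions as real parts\<close>

lemma partial_deriv_has_real_derivative:
  assumes "f differentiable (at (x + t *\<^sub>R b))"
  shows "((\<lambda>t. f (x + t *\<^sub>R b)) has_real_derivative partial_deriv b f (x + t *\<^sub>R b)) (at t)"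
proof -
  obtain D where D: "(f has_derivative D) (at (x + t *\<^sub>R b))"
    using assms by (auto simp: differentiable_def)
  have lin: "D (s *\<^sub>R b) = D b * s" for s
    using has_derivative_bounded_linear[OF D] by (simp add: linear_simps)
  have *: "((\<lambda>s. f (y + s *\<^sub>R b)) has_real_derivative D b) (at u)" if "y + u *\<^sub>R b = x + t *\<^sub>R b" for y u
  proof -
    have "((\<lambda>s. y + s *\<^sub>R b) has_derivative (\<lambda>s. s *\<^sub>R b)) (at u)"
      by (auto intro!: derivative_eq_intros)
    then have "((\<lambda>s. f (y + s *\<^sub>R b)) has_derivative (\<lambda>s. D (s *\<^sub>R b))) (at u)"
      using D that by (intro has_derivative_compose[of "\<lambda>s. y + s *\<^sub>R b" _ u UNIV f D]) auto
    then show ?thesis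
      by (simp add: has_field_derivative_def lin)
  qed
  have "partial_deriv b f (x + t *\<^sub>R b) = D b"
    unfolding partial_deriv_def using *[of "x + t *\<^sub>R b" 0] by (intro DERIV_imp_deriv) simp
  then show ?thesis
    using *[of x t] by simp
qed

lemma partial_deriv_eq_derivative:
  assumes "(f has_derivative D) (at x)"
  shows "partial_deriv b f x = D b"
proof -
  have "((\<lambda>t. x + t *\<^sub>R b) has_derivative (\<lambda>t. t *\<^sub>R b)) (at 0)"
    by (auto intro!: derivative_eq_intros)
  then have "((\<lambda>t. f (x + t *\<^sub>R b)) has_derivative (\<lambda>t. D (t *\<^sub>R b))) (at 0)"
    using assms by (intro has_derivative_compose[of "\<lambda>t. x + t *\<^sub>R b" _ 0 UNIV f D]) auto
  moreover have "D (t *\<^sub>R b) = D b * t" for t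
    using has_derivative_bounded_linear[OF assms] by (simp add: linear_simps)
  ultimately have "((\<lambda>t. f (x + t *\<^sub>R b)) has_real_derivative D b) (at 0)"
    by (simp add: has_field_derivative_def)
  then show ?thesis
    unfolding partial_deriv_def by (rule DERIV_imp_deriv)
qed

text \<open>Two applications of the mean value theorem to the second difference, first in direction
  \<open>b\<close> and then in direction \<open>c\<close>.\<close>
lemma second_difference_mean_value:
  fixes h :: "'a::euclidean_space \<Rightarrow> real"
  assumes "open S" "C2_on h S" "b \<in> Basis" "c \<in> Basis" "ball x r \<subseteq> S" "0 < e" "2 * e < r"
  obtains \<xi> \<eta> where "0 < \<xi>" "\<xi> < e" "0 < \<eta>" "\<eta> < e"
    "h (x + e *\<^sub>R b + e *\<^sub>R c) - h (x + e *\<^sub>R b) - h (x + e *\<^sub>R c) + h x =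
       e * e * partial_deriv c (partial_deriv b h) (x + \<xi> *\<^sub>R b + \<eta> *\<^sub>R c)"
proof -
  have inS: "x + s *\<^sub>R b + t *\<^sub>R c \<in> S" if "0 \<le> s" "s \<le> e" "0 \<le> t" "t \<le> e" for s t
  proof -
    have "norm (s *\<^sub>R b + t *\<^sub>R c) \<le> norm (s *\<^sub>R b) + norm (t *\<^sub>R c)"
      by (rule norm_triangle_ineq)
    also have "\<dots> < r"
      using that assms by simp
    also have "norm (s *\<^sub>R b + t *\<^sub>R c) = dist x (x + (s *\<^sub>R b + t *\<^sub>R c))"
      unfolding dist_norm by (subst norm_minus_cancel[symmetric]) simp
    finally have "x + (s *\<^sub>R b + t *\<^sub>R c) \<in> ball x r"
      by (simp only: mem_ball)
    then show ?thesis
      using assms by (auto simp: add.assoc)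
  qed
  have diff: "h differentiable (at z)" "partial_deriv b h differentiable (at z)" if "z \<in> S" for z
    using assms that unfolding C2_on_def by (auto simp: differentiable_on_eq_differentiable_at)
  define g where "g s = h (x + e *\<^sub>R c + s *\<^sub>R b) - h (x + s *\<^sub>R b)" for s
  have "\<exists>\<xi>. 0 < \<xi> \<and> \<xi> < e \<and> g e - g 0 = (e - 0) *
      (partial_deriv b h (x + e *\<^sub>R c + \<xi> *\<^sub>R b) - partial_deriv b h (x + \<xi> *\<^sub>R b))"
    unfolding g_def using inS[of _ e] inS[of _ 0] assms(6)
    by (intro MVT2 DERIV_diff partial_deriv_has_real_derivative diff) (auto simp: add_ac)
  then obtain \<xi> where \<xi>: "0 < \<xi>" "\<xi> < e" and 1: "g e - g 0 = e *
      (partial_deriv b h (x + e *\<^sub>R c + \<xi> *\<^sub>R b) - partial_deriv b h (x + \<xi> *\<^sub>R b))"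
    by auto
  have "\<exists>\<eta>. 0 < \<eta> \<and> \<eta> < e \<and>
      partial_deriv b h (x + \<xi> *\<^sub>R b + e *\<^sub>R c) - partial_deriv b h (x + \<xi> *\<^sub>R b + 0 *\<^sub>R c) =
      (e - 0) * partial_deriv c (partial_deriv b h) (x + \<xi> *\<^sub>R b + \<eta> *\<^sub>R c)"
    using inS[of \<xi>] \<xi> assms(6)
    by (intro MVT2 partial_deriv_has_real_derivative diff) auto
  then obtain \<eta> where \<eta>: "0 < \<eta>" "\<eta> < e" and
    2: "partial_deriv b h (x + \<xi> *\<^sub>R b + e *\<^sub>R c) - partial_deriv b h (x + \<xi> *\<^sub>R b) =
      e * partial_deriv c (partial_deriv b h) (x + \<xi> *\<^sub>R b + \<eta> *\<^sub>R c)"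
    by auto
  show thesis
    using 1 2 \<xi> \<eta> by (intro that[of \<xi> \<eta>]) (auto simp: g_def add_ac)
qed

text \<open>The second difference is symmetric in \<open>b\<close> and \<open>c\<close>, hence so is its limit, the mixed partial
  derivative.\<close>
lemma partial_deriv_commute:
  fixes h :: "'a::euclidean_space \<Rightarrow> real"
  assumes "open S" "C2_on h S" "b \<in> Basis" "c \<in> Basis" "x \<in> S"
  shows "partial_deriv c (partial_deriv b h) x = partial_deriv b (partial_deriv c h) x"
proof (rule ccontr)
  define u v where "u = partial_deriv c (partial_deriv b h)" and "v = partial_deriv b (partial_deriv c h)"
  assume "\<not> ?thesis"
  then have ne: "u x \<noteq> v x" by (simp add: u_def v_def)
  have "isCont u x" "isCont v x"
    using assms unfolding C2_on_def u_def v_def by (auto simp: continuous_on_eq_continuous_at)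
  define d where "d = \<bar>u x - v x\<bar> / 2"
  have "d > 0" using ne by (simp add: d_def)
  obtain r1 where r1: "r1 > 0" "\<And>y. dist y x < r1 \<Longrightarrow> dist (u y) (u x) < d"
    using \<open>isCont u x\<close> \<open>d > 0\<close> unfolding continuous_at_eps_delta by blast
  obtain r2 where r2: "r2 > 0" "\<And>y. dist y x < r2 \<Longrightarrow> dist (v y) (v x) < d"
    using \<open>isCont v x\<close> \<open>d > 0\<close> unfolding continuous_at_eps_delta by blast
  obtain r where r: "r > 0" "ball x r \<subseteq> S"
    using assms openE by blast
  define e where "e = min r (min r1 r2) / 3"
  have e: "0 < e" "2 * e < r" "2 * e < r1" "2 * e < r2"
    using r r1 r2 by (auto simp: e_def min_def)
  have dist: "dist (x + s *\<^sub>R a + t *\<^sub>R a') x < 2 * e"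
    if "0 < s" "s < e" "0 < t" "t < e" "a \<in> Basis" "a' \<in> Basis" for s t and a a' :: 'a
  proof -
    have "norm (s *\<^sub>R a + t *\<^sub>R a') \<le> norm (s *\<^sub>R a) + norm (t *\<^sub>R a')"
      by (rule norm_triangle_ineq)
    also have "\<dots> < 2 * e"
      using that by simp
    finally show ?thesis
      by (simp add: dist_norm add.assoc)
  qed
  obtain \<xi> \<eta> where 1: "0 < \<xi>" "\<xi> < e" "0 < \<eta>" "\<eta> < e"
    "h (x + e *\<^sub>R b + e *\<^sub>R c) - h (x + e *\<^sub>R b) - h (x + e *\<^sub>R c) + h x =
       e * e * u (x + \<xi> *\<^sub>R b + \<eta> *\<^sub>R c)"
    using second_difference_mean_value[OF assms(1-4) r(2) e(1,2)] unfolding u_def by blast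
  obtain \<xi>' \<eta>' where 2: "0 < \<xi>'" "\<xi>' < e" "0 < \<eta>'" "\<eta>' < e"
    "h (x + e *\<^sub>R c + e *\<^sub>R b) - h (x + e *\<^sub>R c) - h (x + e *\<^sub>R b) + h x =
       e * e * v (x + \<xi>' *\<^sub>R c + \<eta>' *\<^sub>R b)"
    using second_difference_mean_value[OF assms(1,2,4,3) r(2) e(1,2)] unfolding v_def by blast
  have "e * e * u (x + \<xi> *\<^sub>R b + \<eta> *\<^sub>R c) = e * e * v (x + \<xi>' *\<^sub>R c + \<eta>' *\<^sub>R b)"
    unfolding 1(5)[symmetric] 2(5)[symmetric] by (simp add: add_ac)
  then have "u (x + \<xi> *\<^sub>R b + \<eta> *\<^sub>R c) = v (x + \<xi>' *\<^sub>R c + \<eta>' *\<^sub>R b)"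
    using e by simp
  moreover have "dist (u (x + \<xi> *\<^sub>R b + \<eta> *\<^sub>R c)) (u x) < d"
    using dist[OF 1(1-4) assms(3,4)] e by (intro r1) linarith
  moreover have "dist (v (x + \<xi>' *\<^sub>R c + \<eta>' *\<^sub>R b)) (v x) < d"
    using dist[OF 2(1-4) assms(4,3)] e by (intro r2) linarith
  ultimately show False
    unfolding d_def dist_real_def by (auto simp: abs_if split: if_splits)
qed

text \<open>Real parts of holomorphic functions, locally. For a \<open>C\<^sup>2\<close> function this is harmonicity; in
  this form it is evidently stable under linear combinations and gives direct access to power
  series. The balls are required to lie in the set, so a set admitting such a function is open.\<close>
definition locally_Re_holomorphic :: "(complex \<Rightarrow> real) \<Rightarrow> complex set \<Rightarrow> bool" where
  "locally_Re_holomorphic h S \<longleftrightarrow>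
     (\<forall>z\<in>S. \<exists>r>0. \<exists>f. ball z r \<subseteq> S \<and> f holomorphic_on ball z r \<and> (\<forall>w\<in>ball z r. h w = Re (f w)))"

text \<open>The complex gradient \<open>h\<^sub>x - \<i> h\<^sub>y\<close> satisfies the Cauchy-Riemann equations: one of them is
  Laplace's equation, the other the symmetry of the second derivatives. A primitive on a ball has,
  up to a constant, the real part \<open>h\<close>.\<close>
lemma harmonic_on_imp_locally_Re_holomorphic:
  assumes "harmonic_on h S"
  shows "locally_Re_holomorphic h S"
  unfolding locally_Re_holomorphic_def
proof
  have "open S" and C2: "C2_on h S" and lap: "\<And>z. z \<in> S \<Longrightarrow> laplacian h z = 0"
    using assms by (auto simp: harmonic_on_def)
  define hx hy where "hx = partial_deriv 1 h" and "hy = partial_deriv \<i> h"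
  define G where "G z = of_real (hx z) - \<i> * of_real (hy z)" for z
  have basis: "1 \<in> (Basis :: complex set)" "\<i> \<in> (Basis :: complex set)"
    by (auto simp: Basis_complex_def)
  have split: "D d = Re d * D 1 + Im d * D \<i>" if "linear D" for D :: "complex \<Rightarrow> real" and d
  proof -
    have "D d = D (Re d *\<^sub>R 1 + Im d *\<^sub>R \<i>)"
      by (intro arg_cong[of _ _ D]) (simp add: complex_eq_iff)
    also have "\<dots> = Re d * D 1 + Im d * D \<i>"
      using that by (simp add: linear_add linear_scale del: scaleR_conv_of_real)
    finally show ?thesis .
  qed
  have G: "G field_differentiable (at z)" if "z \<in> S" for z
  proof -
    have "hx differentiable (at z)" "hy differentiable (at z)"
      using C2 basis that \<open>open S\<close> unfolding C2_on_def hx_def hy_def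
      by (auto simp: differentiable_on_eq_differentiable_at)
    then obtain A B where A: "(hx has_derivative A) (at z)" and B: "(hy has_derivative B) (at z)"
      by (auto simp: differentiable_def)
    have "A \<i> = B 1"
      using partial_deriv_commute[OF \<open>open S\<close> C2 basis that]
        partial_deriv_eq_derivative[OF A] partial_deriv_eq_derivative[OF B]
      by (simp add: hx_def hy_def)
    moreover have "A 1 + B \<i> = 0"
      using lap[OF that] partial_deriv_eq_derivative[OF A] partial_deriv_eq_derivative[OF B]
      by (simp add: laplacian_def Basis_complex_def hx_def hy_def)
    then have "B \<i> = - A 1" by simp
    moreover have "linear A" "linear B"
      using A B has_derivative_linear by blast+
    ultimately have AB: "A d = Re d * A 1 + Im d * B 1" "B d = Re d * B 1 - Im d * A 1" for d
      using split[of A d] split[of B d] by simp_all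
    have "of_real (A d) - \<i> * of_real (B d) = (of_real (A 1) - \<i> * of_real (B 1)) * d" for d
      unfolding complex_eq_iff using AB[of d] by (simp add: algebra_simps)
    then have "(\<lambda>d. of_real (A d) - \<i> * of_real (B d)) = (*) (of_real (A 1) - \<i> * of_real (B 1))"
      by (rule ext)
    moreover have "(G has_derivative (\<lambda>d. of_real (A d) - \<i> * of_real (B d))) (at z)"
      unfolding G_def by (auto intro!: derivative_eq_intros A B)
    ultimately show ?thesis
      unfolding field_differentiable_def has_field_derivative_def by auto
  qed
  fix z assume "z \<in> S"
  obtain r where r: "r > 0" "ball z r \<subseteq> S"
    using \<open>open S\<close> \<open>z \<in> S\<close> by (rule openE)
  have "G holomorphic_on ball z r"
    using G r by (auto simp: holomorphic_on_def intro: field_differentiable_at_within)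
  then obtain f where f: "\<And>w. w \<in> ball z r \<Longrightarrow> (f has_field_derivative G w) (at w within ball z r)"
    using holomorphic_convex_primitive'[OF convex_ball open_ball \<open>G holomorphic_on ball z r\<close>] by blast
  have "((\<lambda>w. h w - Re (f w)) has_derivative (\<lambda>_. 0)) (at w within ball z r)" if w: "w \<in> ball z r" for w
  proof -
    have "h differentiable (at w)"
      using C2 w r \<open>open S\<close> unfolding C2_on_def by (auto simp: differentiable_on_eq_differentiable_at)
    then obtain D where D: "(h has_derivative D) (at w)"
      by (auto simp: differentiable_def)
    have "D d = Re d * hx w + Im d * hy w" for d
      using split[of D d] has_derivative_linear[OF D] partial_deriv_eq_derivative[OF D]
      by (simp add: hx_def hy_def)
    then have "D = (\<lambda>d. Re (G w * d))"
      by (auto simp: fun_eq_iff G_def)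
    then have "(h has_derivative (\<lambda>d. Re (G w * d))) (at w within ball z r)"
      using D has_derivative_at_withinI by blast
    moreover have "((\<lambda>w. Re (f w)) has_derivative (\<lambda>d. Re (G w * d))) (at w within ball z r)"
      using f[OF w] unfolding has_field_derivative_def by (rule has_derivative_Re)
    ultimately show ?thesis
      using has_derivative_diff by fastforce
  qed
  then obtain k where k: "\<And>w. w \<in> ball z r \<Longrightarrow> h w - Re (f w) = k"
    using has_derivative_zero_constant[OF convex_ball, of z r "\<lambda>w. h w - Re (f w)"] by blast
  show "\<exists>r>0. \<exists>f. ball z r \<subseteq> S \<and> f holomorphic_on ball z r \<and> (\<forall>w\<in>ball z r. h w = Re (f w))"
  proof (intro exI conjI ballI)
    have "f holomorphic_on ball z r"
      using f unfolding holomorphic_on_def field_differentiable_def by blast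
    then show "(\<lambda>w. f w + of_real k) holomorphic_on ball z r"
      by (intro holomorphic_intros)
    show "h w = Re (f w + of_real k)" if "w \<in> ball z r" for w
      using k[OF that] by simp
  qed (use r in auto)
qed

lemma locally_Re_holomorphic_const: "open S \<Longrightarrow> locally_Re_holomorphic (\<lambda>_. c) S"
  unfolding locally_Re_holomorphic_def
  by (metis Re_complex_of_real holomorphic_on_const openE)

lemma locally_Re_holomorphic_add:
  assumes "locally_Re_holomorphic h S" "locally_Re_holomorphic k S"
  shows "locally_Re_holomorphic (\<lambda>z. h z + k z) S"
  unfolding locally_Re_holomorphic_def
proof
  fix z assume "z \<in> S"
  obtain r f where f: "r > 0" "ball z r \<subseteq> S" "f holomorphic_on ball z r" "\<forall>w\<in>ball z r. h w = Re (f w)"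
    using assms(1) \<open>z \<in> S\<close> unfolding locally_Re_holomorphic_def by blast
  obtain s g where g: "s > 0" "ball z s \<subseteq> S" "g holomorphic_on ball z s" "\<forall>w\<in>ball z s. k w = Re (g w)"
    using assms(2) \<open>z \<in> S\<close> unfolding locally_Re_holomorphic_def by blast
  have "(\<lambda>w. f w + g w) holomorphic_on ball z (min r s)"
    using f g by (intro holomorphic_on_add) (auto elim: holomorphic_on_subset)
  then show "\<exists>r>0. \<exists>f. ball z r \<subseteq> S \<and> f holomorphic_on ball z r \<and> (\<forall>w\<in>ball z r. h w + k w = Re (f w))"
    using f g by (intro exI[of _ "min r s"] exI[of _ "\<lambda>w. f w + g w"]) auto
qed

lemma locally_Re_holomorphic_cmult:
  assumes "locally_Re_holomorphic h S"
  shows "locally_Re_holomorphic (\<lambda>z. c * h z) S"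
  unfolding locally_Re_holomorphic_def
proof
  fix z assume "z \<in> S"
  obtain r f where f: "r > 0" "ball z r \<subseteq> S" "f holomorphic_on ball z r" "\<forall>w\<in>ball z r. h w = Re (f w)"
    using assms(1) \<open>z \<in> S\<close> unfolding locally_Re_holomorphic_def by blast
  then show "\<exists>r>0. \<exists>f. ball z r \<subseteq> S \<and> f holomorphic_on ball z r \<and> (\<forall>w\<in>ball z r. c * h w = Re (f w))"
    by (intro exI[of _ r] exI[of _ "\<lambda>w. of_real c * f w"]) (auto intro: holomorphic_intros)
qed

lemma locally_Re_holomorphic_sum:
  assumes "open S" "\<And>i. i \<in> I \<Longrightarrow> locally_Re_holomorphic (h i) S"
  shows "locally_Re_holomorphic (\<lambda>z. \<Sum>i\<in>I. h i z) S"
  using assms(2)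
  by (induction I rule: infinite_finite_induct)
     (auto intro: locally_Re_holomorphic_const[OF assms(1)] locally_Re_holomorphic_add)

section \<open>Local behaviour and the maximum principle\<close>

text \<open>Near \<open>z\<close>, a nonconstant \<open>f\<close> behaves like \<open>f z - (\<zeta> / \<omega>)\<^sup>n\<close> with \<open>\<zeta> = w - z\<close>, so along the rays
  with direction \<open>\<omega> e\<^sup>i\<^sup>\<theta>\<close> the increment of \<open>Re f\<close> has the sign of \<open>- cos (n \<theta>)\<close>. At a critical point
  there are at least four sectors of alternating sign.\<close>
lemma Re_holomorphic_alternating_rays:
  assumes f: "f holomorphic_on ball z r" and "r > 0" and nonconst: "\<not> f constant_on ball z r"
  obtains \<omega> n where "\<omega> \<noteq> 0" "n > 0" "deriv f z = 0 \<longrightarrow> n \<ge> 2"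
    "\<And>\<theta>. cos (real n * \<theta>) < 0 \<Longrightarrow> \<forall>\<^sub>F t in at_right 0. Re (f (z + of_real t * \<omega> * cis \<theta>)) > Re (f z)"
    "\<And>\<theta>. cos (real n * \<theta>) > 0 \<Longrightarrow> \<forall>\<^sub>F t in at_right 0. Re (f (z + of_real t * \<omega> * cis \<theta>)) < Re (f z)"
proof -
  have hol: "(\<lambda>w. f w - f z) holomorphic_on ball z r"
    using f by (intro holomorphic_intros)
  have "\<not> (\<lambda>w. f w - f z) constant_on ball z r"
  proof
    assume "(\<lambda>w. f w - f z) constant_on ball z r"
    then obtain c where "\<forall>w\<in>ball z r. f w - f z = c"
      unfolding constant_on_def by blast
    then have "\<forall>w\<in>ball z r. f w = c + f z"
      by (metis diff_add_cancel)
    then show False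
      using nonconst unfolding constant_on_def by blast
  qed
  then obtain g s n where n: "n > 0" and s: "s > 0" and g: "g holomorphic_on ball z s"
    and fg: "\<And>w. w \<in> ball z s \<Longrightarrow> f w - f z = (w - z) ^ n * g w"
    and gnz: "\<And>w. w \<in> ball z s \<Longrightarrow> g w \<noteq> 0"
    using \<open>r > 0\<close>
    by (elim holomorphic_factor_zero_nonconstant[OF hol open_ball connected_ball, of z, rotated 2]) auto
  have gz: "g z \<noteq> 0" and contg: "isCont g z"
    using gnz s holomorphic_on_imp_continuous_on[OF g] by (auto simp: continuous_on_eq_continuous_at)
  \<comment> \<open>The base direction makes the leading coefficient equal to \<open>-1\<close>.\<close>
  define \<omega> where "\<omega> = exp (Ln (- 1 / g z) / n)"
  have "\<omega> ^ n = - 1 / g z"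
    using n gz by (simp add: \<omega>_def exp_of_nat_mult[symmetric])
  have "\<omega> \<noteq> 0"
    by (simp add: \<omega>_def)
  have "n \<ge> 2" if "deriv f z = 0"
  proof (rule ccontr)
    assume "\<not> n \<ge> 2"
    then have "n = 1" using n by simp
    have "(g has_field_derivative deriv g z) (at z)"
      using g s by (intro holomorphic_derivI[of _ "ball z s"]) auto
    then have "((\<lambda>w. f z + (w - z) * g w) has_field_derivative g z) (at z)"
      by (auto intro!: derivative_eq_intros)
    then have "(f has_field_derivative g z) (at z)"
    proof (rule has_field_derivative_transform_within_open)
      show "f z + (w - z) * g w = f w" if "w \<in> ball z s" for w
        using fg[OF that] \<open>n = 1\<close> by (simp add: diff_eq_eq add.commute)
    qed (use s in auto)
    then show False
      using that gz DERIV_imp_deriv[of f "g z" z] by simp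
  qed
  have expand: "\<forall>\<^sub>F t in at_right 0. Re (f (z + of_real t * \<omega> * cis \<theta>)) - Re (f z)
      = t ^ n * Re (- cis (real n * \<theta>) * (g (z + of_real t * \<omega> * cis \<theta>) / g z))" for \<theta>
  proof -
    have "\<forall>\<^sub>F t in at_right 0. t < s / cmod \<omega>"
      using s \<open>\<omega> \<noteq> 0\<close> by (intro order_tendstoD(2)[OF tendsto_ident_at]) simp
    then show ?thesis
      using eventually_at_right_less
    proof eventually_elim
      case (elim t)
      define w where "w = z + of_real t * \<omega> * cis \<theta>"
      have "dist z w = t * cmod \<omega>"
        using elim by (simp add: w_def dist_norm norm_mult)
      then have "w \<in> ball z s"
        using elim \<open>\<omega> \<noteq> 0\<close> by (simp add: field_simps)
      then have "f w - f z = (of_real t * \<omega> * cis \<theta>) ^ n * g w"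
        using fg[of w] by (simp add: w_def)
      also have "\<dots> = of_real (t ^ n) * (- cis (real n * \<theta>) * (g w / g z))"
        unfolding power_mult_distrib \<open>\<omega> ^ n = _\<close> Complex.DeMoivre by simp
      finally have eq: "f w - f z = of_real (t ^ n) * (- cis (real n * \<theta>) * (g w / g z))" .
      have "Re (of_real c * x) = c * Re x" for c x
        by simp
      then have "Re (f w - f z) = t ^ n * Re (- cis (real n * \<theta>) * (g w / g z))"
        unfolding eq .
      then show ?case
        by (simp add: w_def)
    qed
  qed
  have lim: "((\<lambda>t. Re (- cis (real n * \<theta>) * (g (z + of_real t * \<omega> * cis \<theta>) / g z))) \<longlongrightarrow> - cos (real n * \<theta>)) (at_right 0)" for \<theta>
  proof -
    have "((\<lambda>t. z + of_real t * \<omega> * cis \<theta>) \<longlongrightarrow> z + of_real 0 * \<omega> * cis \<theta>) (at_right 0)"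
      by (intro tendsto_intros)
    then have "((\<lambda>t. g (z + of_real t * \<omega> * cis \<theta>)) \<longlongrightarrow> g z) (at_right 0)"
      using contg by (intro isCont_tendsto_compose[of _ g]) auto
    then have "((\<lambda>t. Re (- cis (real n * \<theta>) * (g (z + of_real t * \<omega> * cis \<theta>) / g z))) \<longlongrightarrow>
        Re (- cis (real n * \<theta>) * (g z / g z))) (at_right 0)"
      using gz by (intro tendsto_intros)
    then show ?thesis
      using gz by simp
  qed
  show thesis
  proof (rule that[OF \<open>\<omega> \<noteq> 0\<close> n])
    show "deriv f z = 0 \<longrightarrow> n \<ge> 2"
      using \<open>deriv f z = 0 \<Longrightarrow> n \<ge> 2\<close> by blast
    show "\<forall>\<^sub>F t in at_right 0. Re (f (z + of_real t * \<omega> * cis \<theta>)) > Re (f z)" if "cos (real n * \<theta>) < 0" for \<theta>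
    proof -
      have "\<forall>\<^sub>F t in at_right 0. Re (- cis (real n * \<theta>) * (g (z + of_real t * \<omega> * cis \<theta>) / g z)) > 0"
        using that by (intro order_tendstoD(1)[OF lim]) simp
      with expand[of \<theta>] eventually_at_right_less[of 0] show ?thesis
      proof eventually_elim
        case (elim t)
        then have "Re (f (z + of_real t * \<omega> * cis \<theta>)) - Re (f z) > 0"
          by (simp only: zero_less_power mult_pos_pos)
        then show ?case by simp
      qed
    qed
    show "\<forall>\<^sub>F t in at_right 0. Re (f (z + of_real t * \<omega> * cis \<theta>)) < Re (f z)" if "cos (real n * \<theta>) > 0" for \<theta>
    proof -
      have "\<forall>\<^sub>F t in at_right 0. Re (- cis (real n * \<theta>) * (g (z + of_real t * \<omega> * cis \<theta>) / g z)) < 0"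
        using that by (intro order_tendstoD(2)[OF lim]) simp
      with expand[of \<theta>] eventually_at_right_less[of 0] show ?thesis
      proof eventually_elim
        case (elim t)
        then have "Re (f (z + of_real t * \<omega> * cis \<theta>)) - Re (f z) < 0"
          by (simp only: zero_less_power mult_pos_neg)
        then show ?case by simp
      qed
    qed
  qed
qed

lemma Re_holomorphic_local_max_imp_constant:
  assumes f: "f holomorphic_on ball z r" and "r > 0" and max: "\<And>w. w \<in> ball z r \<Longrightarrow> Re (f w) \<le> Re (f z)"
  shows "f constant_on ball z r"
proof (rule ccontr)
  assume "\<not> ?thesis"
  then obtain \<omega> n where n: "n > 0" "\<omega> \<noteq> 0" and
    ev: "\<And>\<theta>. cos (real n * \<theta>) < 0 \<Longrightarrow> \<forall>\<^sub>F t in at_right 0. Re (f (z + of_real t * \<omega> * cis \<theta>)) > Re (f z)"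
    by (rule Re_holomorphic_alternating_rays[OF f \<open>r > 0\<close>]) blast
  define \<theta> where "\<theta> = pi / n"
  have "\<forall>\<^sub>F t in at_right 0. Re (f (z + of_real t * \<omega> * cis \<theta>)) > Re (f z)"
    using n by (intro ev) (simp add: \<theta>_def)
  moreover have "\<forall>\<^sub>F t in at_right 0. z + of_real t * \<omega> * cis \<theta> \<in> ball z r"
  proof -
    have "((\<lambda>t. z + of_real t * \<omega> * cis \<theta>) \<longlongrightarrow> z + of_real 0 * \<omega> * cis \<theta>) (at_right 0)"
      by (intro tendsto_intros)
    then show ?thesis
      using \<open>r > 0\<close> by (intro topological_tendstoD[where S = "ball z r"]) auto
  qed
  ultimately have "\<forall>\<^sub>F t in at_right (0::real). False"
    by eventually_elim (use max in force)
  then show False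
    by simp
qed

lemma locally_Re_holomorphic_max_principle:
  assumes "bounded U" "open U" and cont: "continuous_on (closure U) h"
    and loc: "locally_Re_holomorphic h U" and bd: "\<And>z. z \<in> frontier U \<Longrightarrow> h z \<le> 0" and "x \<in> U"
  shows "h x \<le> 0"
proof (rule ccontr)
  assume "\<not> ?thesis"
  have "compact (closure U)"
    using \<open>bounded U\<close> by simp
  then obtain m where m: "m \<in> closure U" "\<And>z. z \<in> closure U \<Longrightarrow> h z \<le> h m"
    using continuous_attains_sup[OF _ _ cont] \<open>x \<in> U\<close> closure_subset by blast
  have "h m > 0"
    using m(2)[of x] \<open>\<not> h x \<le> 0\<close> \<open>x \<in> U\<close> closure_subset by fastforce
  \<comment> \<open>Among the maximum points, the one furthest to the right has no room to be interior.\<close>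
  define K where "K = {z \<in> closure U. h z = h m}"
  have "compact K"
  proof -
    have "closedin (top_of_set (closure U)) K"
      unfolding K_def using cont by (intro continuous_closedin_preimage_constant)
    then show ?thesis
      using \<open>compact (closure U)\<close> closedin_compact by blast
  qed
  moreover have "K \<noteq> {}"
    using m by (auto simp: K_def)
  ultimately obtain y where y: "y \<in> K" "\<And>z. z \<in> K \<Longrightarrow> Re z \<le> Re y"
    using continuous_attains_sup[of K Re, OF _ _ continuous_on_Re[OF continuous_on_id]] by blast
  have "y \<in> U"
    using y bd[of y] \<open>h m > 0\<close> \<open>open U\<close> by (force simp: K_def frontier_def interior_open)
  then obtain r f where f: "r > 0" "ball y r \<subseteq> U" "f holomorphic_on ball y r"
    "\<And>w. w \<in> ball y r \<Longrightarrow> h w = Re (f w)"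
    using loc unfolding locally_Re_holomorphic_def by blast
  have yr: "y \<in> ball y r" using f by simp
  have cl: "ball y r \<subseteq> closure U"
    using f closure_subset by blast
  have "Re (f w) \<le> Re (f y)" if "w \<in> ball y r" for w
    using f(4)[OF that] f(4)[OF yr] m(2)[of w] y(1) that cl by (auto simp: K_def)
  then obtain c where c: "\<And>w. w \<in> ball y r \<Longrightarrow> f w = c"
    using Re_holomorphic_local_max_imp_constant[OF f(3,1)] unfolding constant_on_def by blast
  define w where "w = y + of_real (r / 2)"
  have "w \<in> ball y r"
    using f(1) by (simp add: w_def dist_norm norm_divide)
  then have "h w = h y"
    using c f(4) yr by metis
  then have "w \<in> K"
    using y(1) cl \<open>w \<in> ball y r\<close> by (auto simp: K_def)
  then show False
    using y(2)[of w] f(1) by (simp add: w_def)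
qed

text \<open>Identity theorem: a function that is constant on some ball is constant on the whole
  connected open set.\<close>
lemma locally_Re_holomorphic_eq_const:
  assumes "open S" "connected S" and loc: "locally_Re_holomorphic h S"
    and "x \<in> S" "r > 0" "\<And>w. w \<in> ball x r \<Longrightarrow> h w = k" and "y \<in> S"
  shows "h y = k"
proof -
  define T where "T = {z \<in> S. \<exists>r>0. \<forall>w\<in>ball z r. h w = k}"
  have "open T"
  proof (subst open_subopen, safe)
    fix z assume "z \<in> T"
    then obtain r where r: "r > 0" "\<forall>w\<in>ball z r. h w = k" and "z \<in> S"
      unfolding T_def by blast
    have "S \<inter> ball z r \<subseteq> T"
    proof
      fix w assume w: "w \<in> S \<inter> ball z r"
      obtain e where "e > 0" "ball w e \<subseteq> ball z r"
        using w open_ball openE by blast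
      then show "w \<in> T"
        using r w unfolding T_def by blast
    qed
    then show "\<exists>T'. open T' \<and> z \<in> T' \<and> T' \<subseteq> T"
      using r \<open>z \<in> S\<close> \<open>open S\<close> by (intro exI[of _ "S \<inter> ball z r"]) auto
  qed
  moreover have "open (S - T)"
  proof (subst open_subopen, safe)
    fix z assume z: "z \<in> S" "z \<notin> T"
    obtain r f where f: "r > 0" "ball z r \<subseteq> S" "f holomorphic_on ball z r"
      "\<And>w. w \<in> ball z r \<Longrightarrow> h w = Re (f w)"
      using loc z unfolding locally_Re_holomorphic_def by blast
    have False if w: "w \<in> ball z r" "w \<in> T" for w
    proof -
      obtain e where e: "e > 0" "\<forall>v\<in>ball w e. h v = k"
        using w unfolding T_def by blast
      obtain e' where e': "e' > 0" "ball w e' \<subseteq> ball z r"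
        using w open_ball openE by blast
      define d where "d = min e e'"
      have d: "d > 0" "ball w d \<subseteq> ball z r" "\<And>v. v \<in> ball w d \<Longrightarrow> h v = k"
        using e e' by (auto simp: d_def)
      have "Re (f v) \<le> Re (f w)" if v: "v \<in> ball w d" for v
      proof -
        have "Re (f v) = k" "Re (f w) = k"
          using f(4)[of v] f(4)[of w] d(3)[of v] d(3)[of w] d(1,2) v w by auto
        then show ?thesis by simp
      qed
      then have "f constant_on ball w d"
        using d f(3) by (intro Re_holomorphic_local_max_imp_constant) (auto elim: holomorphic_on_subset)
      then obtain c where c: "\<And>v. v \<in> ball w d \<Longrightarrow> f v = c"
        unfolding constant_on_def by blast
      have "f v = c" if v: "v \<in> ball z r" for v
      proof (rule analytic_continuation_open[of "ball w d" "ball z r" f "\<lambda>_. c"])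
        show "ball w d \<noteq> {}" using d by simp
      qed (use d f(3) v c in auto)
      moreover have "Re c = k"
        using c[of w] d(1) d(3)[of w] f(4)[of w] w by simp
      ultimately have "\<forall>v\<in>ball z r. h v = k"
        using f(4) by simp
      then show False
        using z f(1) unfolding T_def by blast
    qed
    then show "\<exists>T'. open T' \<and> z \<in> T' \<and> T' \<subseteq> S - T"
      using f(1,2) by (intro exI[of _ "ball z r"]) auto
  qed
  moreover have "x \<in> T"
    using assms unfolding T_def by blast
  ultimately have "S \<subseteq> T"
    using \<open>connected S\<close> \<open>x \<in> S\<close> connectedD[of S T "S - T"] by blast
  then obtain e where "e > 0" "\<forall>w\<in>ball y e. h w = k"
    using \<open>y \<in> S\<close> unfolding T_def by blast
  then show ?thesis by simp
qed

text \<open>A piece of the positivity set away from the positive part of the boundary would be an open set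
  with \<open>h \<le> 0\<close> on its frontier, against the maximum principle. No regularity of the boundary of \<open>V\<close>
  is needed.\<close>
lemma connected_positivity_set:
  assumes "compact V" and cont: "continuous_on V h" and loc: "locally_Re_holomorphic h (interior V)"
    and conn: "connected {z \<in> frontier V. h z > 0}"
  shows "connected {z \<in> V. h z > 0}"
proof (rule ccontr)
  define P where "P = {z \<in> V. h z > 0}"
  define Q where "Q = {z \<in> frontier V. h z > 0}"
  have "closed V" "Q \<subseteq> P"
    using \<open>compact V\<close> compact_imp_closed frontier_subset_closed by (auto simp: P_def Q_def)
  have impossible: False
    if AB: "open A" "open B" "P \<subseteq> A \<union> B" "A \<inter> B \<inter> P = {}" "B \<inter> P \<noteq> {}" "B \<inter> Q = {}" for A B
  proof -
    define U where "U = B \<inter> P"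
    have "U \<subseteq> interior V"
      using AB(6) \<open>closed V\<close> by (auto simp: U_def P_def Q_def frontier_def)
    have "U = B \<inter> (interior V \<inter> h -` {0<..})"
      using \<open>U \<subseteq> interior V\<close> interior_subset by (auto simp: U_def P_def)
    moreover have "open (interior V \<inter> h -` {0<..})"
      using cont interior_subset by (intro continuous_open_preimage) (auto intro: continuous_on_subset[OF cont])
    ultimately have "open U"
      using AB by auto
    have "bounded U"
      using \<open>compact V\<close> compact_imp_bounded bounded_subset[of V U] by (auto simp: U_def P_def)
    have clU: "closure U \<subseteq> V"
      using \<open>closed V\<close> by (intro closure_minimal) (auto simp: U_def P_def)
    obtain x where "x \<in> U"
      using AB by (auto simp: U_def)
    have "h x \<le> 0"
    proof (rule locally_Re_holomorphic_max_principle[OF \<open>bounded U\<close> \<open>open U\<close>])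
      show "continuous_on (closure U) h"
        using cont clU by (rule continuous_on_subset)
      show "locally_Re_holomorphic h U"
        unfolding locally_Re_holomorphic_def
      proof
        fix z assume "z \<in> U"
        then obtain r f where f: "r > 0" "f holomorphic_on ball z r" "\<forall>w\<in>ball z r. h w = Re (f w)"
          using loc \<open>U \<subseteq> interior V\<close> unfolding locally_Re_holomorphic_def by blast
        obtain s where s: "s > 0" "ball z s \<subseteq> U"
          using \<open>open U\<close> \<open>z \<in> U\<close> by (rule openE)
        show "\<exists>r>0. \<exists>f. ball z r \<subseteq> U \<and> f holomorphic_on ball z r \<and> (\<forall>w\<in>ball z r. h w = Re (f w))"
        proof (intro exI conjI)
          show "f holomorphic_on ball z (min r s)"
            using f(2) by (rule holomorphic_on_subset) auto
        qed (use f s in auto)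
      qed
      show "h z \<le> 0" if z: "z \<in> frontier U" for z
      proof (rule ccontr)
        assume "\<not> h z \<le> 0"
        have "z \<in> closure U" "z \<notin> U"
          using z \<open>open U\<close> by (auto simp: frontier_def interior_open)
        then have "z \<in> P"
          using clU \<open>\<not> h z \<le> 0\<close> by (auto simp: P_def)
        then have "z \<in> A"
          using \<open>z \<notin> U\<close> AB(3) by (auto simp: U_def)
        then have "A \<inter> U \<noteq> {}"
          using \<open>z \<in> closure U\<close> AB(1) open_Int_closure_eq_empty by blast
        then show False
          using AB(4) by (auto simp: U_def)
      qed
    qed fact
    then show False
      using \<open>x \<in> U\<close> by (auto simp: U_def P_def)
  qed
  assume "\<not> connected {z \<in> V. h z > 0}"
  then obtain A B where AB: "open A" "open B" "P \<subseteq> A \<union> B" "A \<inter> B \<inter> P = {}" "A \<inter> P \<noteq> {}" "B \<inter> P \<noteq> {}"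
    unfolding connected_def P_def by blast
  have "A \<inter> Q = {} \<or> B \<inter> Q = {}"
    using conn connectedD[of Q A B] AB \<open>Q \<subseteq> P\<close> unfolding Q_def by blast
  then show False
    using impossible[of A B] impossible[of B A] AB by blast
qed

section \<open>Planarity\<close>

text \<open>Four rays leave the origin, alternately inside two disjoint connected open sets. This is
  impossible in the plane. Join the two rays in \<open>P\<close> by a path in \<open>P\<close>, and close it up once through the
  origin (\<open>\<gamma>\<close>) and once by cutting off the corner (\<open>\<gamma>'\<close>). The two loops differ by a triangle that
  surrounds a point \<open>x\<close> of the ray \<open>t > 0\<close> but not the far point \<open>e\<close> of that ray, so the differences
  between the winding numbers about \<open>x\<close> and about \<open>e\<close> disagree for the two loops. But \<open>x\<close> and \<open>e\<close> are
  joined off \<open>\<gamma>\<close> inside \<open>N\<close>, and off \<open>\<gamma>'\<close> through the origin, the other ray and a path in \<open>N\<close>.\<close>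
lemma no_crossing_at_origin:
  fixes P N :: "complex set" and \<alpha> \<beta> \<epsilon> :: real
  assumes P: "open P" "connected P" and N: "open N" "connected N"
    and disj: "P \<inter> N = {}" and "0 \<notin> P" "0 \<notin> N"
    and \<alpha>: "0 < \<alpha>" "\<alpha> < pi / 2" and \<beta>: "\<alpha> < \<beta>" "\<beta> < 2 * pi - \<alpha>" and "\<epsilon> > 0"
    and raysP: "\<And>t. 0 < t \<Longrightarrow> t \<le> \<epsilon> \<Longrightarrow> t *\<^sub>R cis \<alpha> \<in> P \<and> t *\<^sub>R cis (-\<alpha>) \<in> P"
    and raysN: "\<And>t. 0 < t \<Longrightarrow> t \<le> \<epsilon> \<Longrightarrow> t *\<^sub>R 1 \<in> N \<and> t *\<^sub>R cis \<beta> \<in> N"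
  shows False
proof -
  have cos_pos: "cos \<alpha> > 0" and sin_pos: "sin \<alpha> > 0" and cos_lt: "cos \<alpha> < 1"
    using \<alpha> by (auto intro!: cos_gt_zero sin_gt_zero cos_monotone_0_pi[of 0 \<alpha>, simplified])
  define e where "e = complex_of_real \<epsilon>"
  have "\<epsilon> *\<^sub>R cis \<beta> \<in> N" "e \<in> N"
    using raysN[of \<epsilon>] \<open>\<epsilon> > 0\<close> by (auto simp: e_def scaleR_conv_of_real)
  then obtain n where n: "path n" "path_image n \<subseteq> N" "pathstart n = \<epsilon> *\<^sub>R cis \<beta>" "pathfinish n = e"
    using connected_open_path_connected[OF N] unfolding path_connected_def by blast
  have "closed (path_image n)" "0 \<notin> path_image n"
    using n \<open>0 \<notin> N\<close> by (auto intro: closed_path_image)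
  then obtain d where d: "d > 0" "ball 0 d \<inter> path_image n = {}"
    using open_contains_ball[of "- path_image n"] by (auto simp: open_Compl disjoint_eq_subset_Compl)
  \<comment> \<open>The corner is cut off at a scale below the distance from the origin to the path in \<open>N\<close>.\<close>
  define s where "s = min (d / 2) (\<epsilon> / 2)"
  have s: "0 < s" "s < d" "s < \<epsilon>"
    using d \<open>\<epsilon> > 0\<close> by (auto simp: s_def)
  define p1 p3 where "p1 = s *\<^sub>R cis (-\<alpha>)" and "p3 = s *\<^sub>R cis \<alpha>"
  have Pp: "p1 \<in> P" "p3 \<in> P"
    using raysP[of s] s by (auto simp: p1_def p3_def)
  obtain g where g: "path g" "path_image g \<subseteq> P" "pathstart g = p3" "pathfinish g = p1"
    using connected_open_path_connected[OF P] Pp unfolding path_connected_def by blast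
  define T where "T = linepath 0 p1 +++ linepath p1 p3 +++ linepath p3 0"
  define \<gamma> where "\<gamma> = linepath 0 p1 +++ reversepath g +++ linepath p3 0"
  define \<gamma>' where "\<gamma>' = linepath p3 p1 +++ reversepath g"
  define m where "m = s * cos \<alpha> / 2"
  have m: "0 < m" "m \<le> \<epsilon>" "m < s * cos \<alpha>" "s * cos \<alpha> < \<epsilon>"
  proof -
    have "s * cos \<alpha> \<le> s" "0 < s * cos \<alpha>"
      using s cos_pos cos_lt by (auto intro!: mult_left_le)
    then show "0 < m" "m \<le> \<epsilon>" "m < s * cos \<alpha>" "s * cos \<alpha> < \<epsilon>"
      unfolding m_def using s by linarith+
  qed
  define x where "x = complex_of_real m"

  have seg1: "closed_segment 0 p1 \<subseteq> insert 0 P" and seg3: "closed_segment p3 0 \<subseteq> insert 0 P"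
  proof -
    have *: "u *\<^sub>R p1 \<in> insert 0 P \<and> u *\<^sub>R p3 \<in> insert 0 P" if "0 \<le> u" "u \<le> 1" for u
    proof -
      have "u * s \<le> s"
        using s that by (intro mult_left_le_one_le) auto
      then have "u * s \<le> \<epsilon>"
        using s by linarith
      then show ?thesis
        using raysP[of "u * s"] s that by (cases "u = 0") (auto simp: p1_def p3_def)
    qed
    have "closed_segment 0 p1 \<subseteq> insert 0 P" "closed_segment 0 p3 \<subseteq> insert 0 P"
      using * unfolding closed_segment_def by (auto simp del: insert_iff)
    then show "closed_segment 0 p1 \<subseteq> insert 0 P" "closed_segment p3 0 \<subseteq> insert 0 P"
      by (simp_all add: closed_segment_commute)
  qed
  have hull: "convex hull {0, p1, p3} \<subseteq> {z. Re z \<le> s * cos \<alpha>}"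
    using s cos_pos by (intro hull_minimal convex_halfspace_Re_le) (auto simp: p1_def p3_def)
  have Re13: "Re z = s * cos \<alpha>" if z: "z \<in> closed_segment p3 p1" for z
  proof -
    obtain u where u: "z = (1 - u) *\<^sub>R p3 + u *\<^sub>R p1"
      using z unfolding closed_segment_def by blast
    show ?thesis
      unfolding u by (simp add: p1_def p3_def algebra_simps)
  qed
  have norm13: "cmod z \<le> s" if "z \<in> closed_segment p3 p1" for z
  proof -
    have "closed_segment p3 p1 \<subseteq> cball 0 s"
      using s by (intro closed_segment_subset) (auto simp: p1_def p3_def)
    then show ?thesis using that by auto
  qed
  have path_im: "path_image \<gamma> \<subseteq> insert 0 P" "path_image \<gamma>' \<subseteq> closed_segment p3 p1 \<union> P"
    using seg1 seg3 g unfolding \<gamma>_def \<gamma>'_def by (auto simp: path_image_join)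
  have paths: "path \<gamma>" "pathfinish \<gamma> = pathstart \<gamma>" "path \<gamma>'" "pathfinish \<gamma>' = pathstart \<gamma>'"
    using g by (auto simp: \<gamma>_def \<gamma>'_def)
  have real_N: "of_real t \<in> N" if "0 < t" "t \<le> \<epsilon>" for t
    using raysN[OF that] by (simp add: scaleR_conv_of_real)

  have x_in: "x \<in> interior (convex hull {0, p1, p3})"
  proof -
    have "\<not> collinear {0, p1, p3}"
    proof
      assume "collinear {0, p1, p3}"
      then obtain c where c: "s *\<^sub>R cis \<alpha> = c *\<^sub>R s *\<^sub>R cis (-\<alpha>)"
        using s by (auto simp: collinear_lemma p1_def p3_def)
      have "c = 1"
        using arg_cong[OF c, of Re] s cos_pos by simp
      then show False
        using arg_cong[OF c, of Im] s sin_pos by simp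
    qed
    moreover have "(1/2) *\<^sub>R 0 + (1/4) *\<^sub>R p1 + (1/4) *\<^sub>R p3 = x"
      by (simp add: x_def m_def p1_def p3_def complex_eq_iff)
    moreover have "1/2 + 1/4 + 1/4 = (1::real)"
      by simp
    ultimately show ?thesis
      unfolding interior_convex_hull_3_minimal[OF \<open>\<not> collinear {0, p1, p3}\<close> DIM_complex] mem_Collect_eq
      by (metis divide_pos_pos zero_less_numeral zero_less_one)
  qed
  have sum: "winding_number \<gamma> z = winding_number \<gamma>' z + winding_number T z"
    if "z \<notin> path_image \<gamma>" "z \<notin> path_image \<gamma>'" for z
  proof -
    have "z \<notin> path_image g" "z \<notin> closed_segment 0 p1" "z \<notin> closed_segment p3 0" "z \<notin> closed_segment p3 p1"
      using that g by (auto simp: \<gamma>_def \<gamma>'_def path_image_join)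
    moreover from this have "z \<notin> closed_segment p1 p3" by (simp add: closed_segment_commute)
    moreover have "winding_number (linepath p3 p1) z = - winding_number (linepath p1 p3) z"
      using winding_number_reversepath[of "linepath p1 p3" z] \<open>z \<notin> closed_segment p1 p3\<close> by simp
    ultimately show ?thesis
      using g unfolding \<gamma>_def \<gamma>'_def T_def
      by (simp add: winding_number_join path_image_join)
  qed
  have in_N: "x \<in> N" "e \<in> N"
    using real_N[of m] real_N[of \<epsilon>] \<open>\<epsilon> > 0\<close> m by (simp_all only: x_def e_def order_refl)
  have "winding_number \<gamma> x = winding_number \<gamma> e"
    using in_N paths path_im disj \<open>0 \<notin> N\<close> N by (intro winding_number_eq[where S = N]) auto
  moreover have "winding_number \<gamma>' x = winding_number \<gamma>' e"
  proof (rule winding_number_eq[where S = "closed_segment x 0 \<union> closed_segment 0 (\<epsilon> *\<^sub>R cis \<beta>) \<union> path_image n"])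
    show "connected (closed_segment x 0 \<union> closed_segment 0 (\<epsilon> *\<^sub>R cis \<beta>) \<union> path_image n)"
    proof (intro connected_Un connected_path_image connected_segment n)
      have "\<epsilon> *\<^sub>R cis \<beta> \<in> path_image n"
        using n by (metis pathstart_in_path_image)
      then show "(closed_segment x 0 \<union> closed_segment 0 (\<epsilon> *\<^sub>R cis \<beta>)) \<inter> path_image n \<noteq> {}"
        by (auto simp del: scaleR_conv_of_real)
      have "0 \<in> closed_segment x 0 \<inter> closed_segment 0 (\<epsilon> *\<^sub>R cis \<beta>)"
        by (simp only: Int_iff ends_in_segment)
      then show "closed_segment x 0 \<inter> closed_segment 0 (\<epsilon> *\<^sub>R cis \<beta>) \<noteq> {}"
        by blast
    qed
    show "x \<in> closed_segment x 0 \<union> closed_segment 0 (\<epsilon> *\<^sub>R cis \<beta>) \<union> path_image n" by simp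
    show "e \<in> closed_segment x 0 \<union> closed_segment 0 (\<epsilon> *\<^sub>R cis \<beta>) \<union> path_image n"
      using n by (metis UnI2 pathfinish_in_path_image)
    have "closed_segment x 0 \<inter> (closed_segment p3 p1 \<union> P) = {}"
    proof -
      have "z \<notin> closed_segment p3 p1 \<and> z \<notin> P" if z: "z \<in> closed_segment x 0" for z
      proof -
        obtain u where u: "0 \<le> u" "u \<le> 1" "z = complex_of_real (u * m)"
          using z[unfolded closed_segment_commute[of x 0]]
          by (auto simp: in_segment x_def scaleR_conv_of_real)
        have "u * m \<le> m"
          using u m by (intro mult_left_le_one_le) auto
        then have um: "u * m < s * cos \<alpha>" "u * m \<le> \<epsilon>"
          using m by linarith+
        then have "z \<notin> closed_segment p3 p1"
          using Re13[of z] u(3) by auto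
        moreover have "z \<notin> P"
        proof (cases "u = 0")
          case False
          then have "z \<in> N"
            unfolding u(3) using u m um by (intro real_N) auto
          then show ?thesis using disj by blast
        qed (use u \<open>0 \<notin> P\<close> in auto)
        ultimately show ?thesis by blast
      qed
      then show ?thesis by blast
    qed
    moreover have "closed_segment 0 (\<epsilon> *\<^sub>R cis \<beta>) \<inter> (closed_segment p3 p1 \<union> P) = {}"
    proof -
      have "z \<notin> closed_segment p3 p1 \<and> z \<notin> P" if z: "z \<in> closed_segment 0 (\<epsilon> *\<^sub>R cis \<beta>)" for z
      proof -
        obtain u where u: "0 \<le> u" "u \<le> 1" "z = (u * \<epsilon>) *\<^sub>R cis \<beta>"
          using z by (auto simp: in_segment)
        have "u * \<epsilon> \<le> \<epsilon>"
          using u \<open>\<epsilon> > 0\<close> by (intro mult_left_le_one_le) auto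
        then have "z \<notin> P"
          using raysN[of "u * \<epsilon>"] u \<open>\<epsilon> > 0\<close> disj \<open>0 \<notin> P\<close> by (cases "u = 0") auto
        moreover have "z \<notin> closed_segment p3 p1"
        proof
          assume z: "z \<in> closed_segment p3 p1"
          have "cos \<beta> < cos \<alpha>"
          proof (cases "\<beta> \<le> pi")
            case True
            then show ?thesis using \<alpha> \<beta> by (intro cos_monotone_0_pi) auto
          next
            case False
            have "cos (2 * pi - \<beta>) < cos \<alpha>"
              using False \<alpha> \<beta> by (intro cos_monotone_0_pi) auto
            then show ?thesis by simp
          qed
          moreover have "cmod z = u * \<epsilon>"
            using u \<open>\<epsilon> > 0\<close> by (simp add: norm_mult)
          then have "u * \<epsilon> \<le> s"
            using norm13[OF z] by simp
          moreover have "u * \<epsilon> * cos \<beta> = s * cos \<alpha>"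
            using Re13[OF z] u by simp
          moreover have "u * \<epsilon> * cos \<beta> \<le> u * \<epsilon> * cos \<alpha>"
            using \<open>cos \<beta> < cos \<alpha>\<close> u \<open>\<epsilon> > 0\<close> by (intro mult_left_mono) auto
          moreover have "u * \<epsilon> * cos \<alpha> \<le> s * cos \<alpha>"
            using \<open>u * \<epsilon> \<le> s\<close> cos_pos by (intro mult_right_mono) auto
          ultimately have "u * \<epsilon> * cos \<alpha> = s * cos \<alpha>" "u * \<epsilon> * cos \<beta> = u * \<epsilon> * cos \<alpha>"
            by linarith+
          then show False
            using cos_pos s \<open>cos \<beta> < cos \<alpha>\<close> by auto
        qed
        ultimately show ?thesis by blast
      qed
      then show ?thesis by blast
    qed
    moreover have "path_image n \<inter> (closed_segment p3 p1 \<union> P) = {}"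
      using n(2) disj d(2) norm13 s by (fastforce simp: disjoint_iff)
    ultimately show "(closed_segment x 0 \<union> closed_segment 0 (\<epsilon> *\<^sub>R cis \<beta>) \<union> path_image n) \<inter> path_image \<gamma>' = {}"
      using path_im(2) by blast
  qed (use paths in auto)
  moreover have "winding_number T e = 0"
  proof (rule winding_number_zero_outside[where s = "convex hull {0, p1, p3}"])
    have "closed_segment 0 p1 \<subseteq> convex hull {0, p1, p3}" "closed_segment p1 p3 \<subseteq> convex hull {0, p1, p3}"
       "closed_segment p3 0 \<subseteq> convex hull {0, p1, p3}"
      unfolding segment_convex_hull by (auto intro!: hull_mono)
    then show "path_image T \<subseteq> convex hull {0, p1, p3}"
      by (simp add: T_def path_image_join)
    show "e \<notin> convex hull {0, p1, p3}"
      using hull m by (auto simp: e_def)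
  qed (auto simp: T_def)
  moreover have "winding_number T x \<noteq> 0"
    unfolding T_def winding_number_triangle[OF x_in] by simp
  moreover have "x \<notin> path_image \<gamma>" "e \<notin> path_image \<gamma>"
    using in_N path_im disj \<open>0 \<notin> N\<close> by auto
  moreover have "x \<notin> path_image \<gamma>'" "e \<notin> path_image \<gamma>'"
    using in_N path_im(2) disj Re13[of x] Re13[of e] m by (auto simp: x_def e_def)
  ultimately show False
    using sum[of x] sum[of e] by simp
qed

text \<open>Separated connected sets have disjoint connected open neighbourhoods, which may in addition
  avoid a common limit point \<open>z\<close>: take around each point the ball of half the distance to the other
  set and \<open>z\<close>. This replaces connected sets by path connected ones.\<close>
lemma separated_connected_open_neighbourhoods:
  fixes A B :: "'a::euclidean_space set"
  assumes "connected A" "connected B"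
    and sep: "A \<inter> closure (insert z B) = {}" "B \<inter> closure (insert z A) = {}"
  obtains A' B' where "open A'" "connected A'" "A \<subseteq> A'" "open B'" "connected B'" "B \<subseteq> B'"
    "A' \<inter> B' = {}" "z \<notin> A'" "z \<notin> B'"
proof -
  define nbhd where "nbhd X Y = (\<Union>x\<in>X. ball x (infdist x (insert z Y) / 2))" for X Y :: "'a set"
  have pos: "infdist x (insert z Y) > 0" if "x \<in> X" "X \<inter> closure (insert z Y) = {}" for x X Y
    using that in_closure_iff_infdist_zero[of "insert z Y" x] infdist_nonneg[of x "insert z Y"] by fastforce
  have "open (nbhd X Y)" for X Y
    by (auto simp: nbhd_def)
  moreover have sub: "X \<subseteq> nbhd X Y" if "X \<inter> closure (insert z Y) = {}" for X Y
  proof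
    fix x assume "x \<in> X"
    then show "x \<in> nbhd X Y"
      unfolding nbhd_def using pos[of x X Y] that by (intro UN_I[of x]) auto
  qed
  moreover have "connected (nbhd X Y)" if "connected X" "X \<inter> closure (insert z Y) = {}" for X Y
  proof -
    have "connected (X \<union> nbhd X Y)"
      unfolding nbhd_def
    proof (rule connected_Un_UN[OF \<open>connected X\<close>])
      show "X \<inter> C \<noteq> {}" if "C \<in> (\<lambda>x. ball x (infdist x (insert z Y) / 2)) ` X" for C
        using that pos \<open>X \<inter> closure (insert z Y) = {}\<close> by fastforce
    qed auto
    then show ?thesis
      using sub[of X Y] that by (simp add: Un_absorb1)
  qed
  moreover have "z \<notin> nbhd X Y" for X Y
  proof
    assume "z \<in> nbhd X Y"
    then obtain x where "dist x z < infdist x (insert z Y) / 2"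
      by (auto simp: nbhd_def)
    moreover have "infdist x (insert z Y) \<le> dist x z"
      by (rule infdist_le) simp
    ultimately show False
      using zero_le_dist[of x z] by linarith
  qed
  moreover have "nbhd A B \<inter> nbhd B A = {}"
  proof -
    have False if w: "w \<in> nbhd A B" "w \<in> nbhd B A" for w
    proof -
      obtain x y where x: "x \<in> A" "dist x w < infdist x (insert z B) / 2"
        and y: "y \<in> B" "dist y w < infdist y (insert z A) / 2"
        using w by (auto simp: nbhd_def)
      have "infdist x (insert z B) \<le> dist x y" "infdist y (insert z A) \<le> dist y x"
        using x y by (auto intro: infdist_le)
      then show False
        using x y dist_triangle[of x y w] by (simp add: dist_commute)
    qed
    then show ?thesis by blast
  qed
  ultimately show thesis
    using assms by (intro that[of "nbhd A B" "nbhd B A"]) auto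
qed

section \<open>Critical points\<close>

text \<open>The heart of the matter. If the zero \<open>z\<close> were critical, the positivity set and the
  negativity set would each contain two sectors at \<open>z\<close>, in alternating order, although each of these
  sets is connected because its trace on the frontier is. Passing to connected open neighbourhoods
  contradicts planarity. The connectedness of the traces is required only once \<open>h\<close> is known to take
  both signs.\<close>
lemma no_critical_zero:
  fixes h :: "complex \<Rightarrow> real"
  assumes "compact V" "connected (interior V)" and cont: "continuous_on V h"
    and loc: "locally_Re_holomorphic h (interior V)"
    and f: "r > 0" "ball z r \<subseteq> interior V" "f holomorphic_on ball z r" "\<And>w. w \<in> ball z r \<Longrightarrow> h w = Re (f w)"
    and crit: "h z = 0" "deriv f z = 0"
    and nonzero: "y \<in> interior V" "h y \<noteq> 0"
    and conn: "\<And>a b. a \<in> V \<Longrightarrow> b \<in> V \<Longrightarrow> h a < 0 \<Longrightarrow> 0 < h b \<Longrightarrow>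
      connected {z \<in> frontier V. h z > 0} \<and> connected {z \<in> frontier V. h z < 0}"
  shows False
proof -
  have zV: "z \<in> interior V" "z \<in> V"
    using f(1,2) interior_subset by fastforce+
  have "\<not> f constant_on ball z r"
  proof
    assume "f constant_on ball z r"
    then obtain c where c: "\<And>w. w \<in> ball z r \<Longrightarrow> f w = c"
      unfolding constant_on_def by blast
    have const: "h w = 0" if "w \<in> ball z r" for w
      using f(4)[OF that] f(4)[of z] c[OF that] c[of z] f(1) crit(1) by simp
    have "h y = 0"
      using locally_Re_holomorphic_eq_const[OF open_interior assms(2) loc zV(1) f(1) const nonzero(1)] .
    then show False
      using nonzero(2) by simp
  qed
  then obtain \<omega> n where \<omega>: "\<omega> \<noteq> 0" and n: "n > 0" "deriv f z = 0 \<longrightarrow> n \<ge> 2"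
    and up: "\<And>\<theta>. cos (real n * \<theta>) < 0 \<Longrightarrow> \<forall>\<^sub>F t in at_right 0. Re (f (z + of_real t * \<omega> * cis \<theta>)) > Re (f z)"
    and down: "\<And>\<theta>. cos (real n * \<theta>) > 0 \<Longrightarrow> \<forall>\<^sub>F t in at_right 0. Re (f (z + of_real t * \<omega> * cis \<theta>)) < Re (f z)"
    using Re_holomorphic_alternating_rays[OF f(3,1)] by metis
  have n2: "real n \<ge> 2"
    using n crit by simp
  \<comment> \<open>The rays at the angles \<open>\<plusminus> \<alpha>\<close> lie in the two positive sectors adjacent to the negative sector
    around angle \<open>0\<close>, and the one at \<open>\<beta>\<close> in the next negative sector. The choice \<open>n \<alpha> = 3 \<pi> / 4\<close>
    keeps the angle \<open>2 \<alpha>\<close> between the positive rays below \<open>\<pi>\<close> also for \<open>n = 2\<close>.\<close>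
  define \<alpha> \<beta> where "\<alpha> = 3 * pi / (4 * real n)" and "\<beta> = 2 * pi / real n"
  have \<alpha>: "0 < \<alpha>" "\<alpha> < pi / 2" and \<beta>: "\<alpha> < \<beta>" "\<beta> < 2 * pi - \<alpha>"
  proof -
    have "\<alpha> \<le> 3 * pi / 8"
      unfolding \<alpha>_def using n2 by (intro divide_left_mono) auto
    moreover have "\<beta> \<le> pi"
      unfolding \<beta>_def using n2 by (simp add: field_simps)
    ultimately show "\<alpha> < pi / 2" "\<beta> < 2 * pi - \<alpha>"
      using pi_gt_zero by linarith+
    show "0 < \<alpha>" "\<alpha> < \<beta>"
      using n2 by (auto simp: \<alpha>_def \<beta>_def field_simps)
  qed
  have ball_ev: "\<forall>\<^sub>F t in at_right 0. z + of_real t * \<omega> * cis \<theta> \<in> ball z r" for \<theta>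
  proof -
    have "((\<lambda>t. z + of_real t * \<omega> * cis \<theta>) \<longlongrightarrow> z + of_real 0 * \<omega> * cis \<theta>) (at_right 0)"
      by (intro tendsto_intros)
    then show ?thesis
      using \<open>r > 0\<close> by (intro topological_tendstoD[where S = "ball z r"]) auto
  qed
  have pos_ev: "\<forall>\<^sub>F t in at_right 0. z + of_real t * \<omega> * cis \<theta> \<in> {w \<in> V. h w > 0}" if "cos (real n * \<theta>) < 0" for \<theta>
    using ball_ev[of \<theta>] up[OF that]
  proof eventually_elim
    case (elim t)
    then show ?case
      using f(2) f(4)[of z] f(4)[OF elim(1)] f(1) crit(1) interior_subset[of V] by auto
  qed
  have neg_ev: "\<forall>\<^sub>F t in at_right 0. z + of_real t * \<omega> * cis \<theta> \<in> {w \<in> V. h w < 0}" if "cos (real n * \<theta>) > 0" for \<theta>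
    using ball_ev[of \<theta>] down[OF that]
  proof eventually_elim
    case (elim t)
    then show ?case
      using f(2) f(4)[of z] f(4)[OF elim(1)] f(1) crit(1) interior_subset[of V] by auto
  qed
  have "cos (3 * pi / 4) < cos (pi / 2)"
    by (intro cos_monotone_0_pi) auto
  then have cosines: "cos (real n * \<alpha>) < 0" "cos (real n * (-\<alpha>)) < 0" "cos (real n * 0) > 0" "cos (real n * \<beta>) > 0"
    using n by (auto simp: \<alpha>_def \<beta>_def)
  have "\<forall>\<^sub>F t in at_right 0. z + of_real t * \<omega> * cis \<alpha> \<in> {w \<in> V. h w > 0} \<and>
      z + of_real t * \<omega> * cis (-\<alpha>) \<in> {w \<in> V. h w > 0} \<and>
      z + of_real t * \<omega> * cis 0 \<in> {w \<in> V. h w < 0} \<and> z + of_real t * \<omega> * cis \<beta> \<in> {w \<in> V. h w < 0}"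
    using cosines by (intro eventually_conj pos_ev neg_ev)
  then obtain \<delta> where \<delta>: "\<delta> > 0" and rays: "\<And>t. 0 < t \<Longrightarrow> t < \<delta> \<Longrightarrow>
      z + of_real t * \<omega> * cis \<alpha> \<in> {w \<in> V. h w > 0} \<and>
      z + of_real t * \<omega> * cis (-\<alpha>) \<in> {w \<in> V. h w > 0} \<and>
      z + of_real t * \<omega> * cis 0 \<in> {w \<in> V. h w < 0} \<and> z + of_real t * \<omega> * cis \<beta> \<in> {w \<in> V. h w < 0}"
    unfolding eventually_at_right_field by auto
  have conn': "connected {z \<in> frontier V. h z > 0}" "connected {z \<in> frontier V. - h z > 0}"
    using conn[of "z + of_real (\<delta>/2) * \<omega> * cis 0" "z + of_real (\<delta>/2) * \<omega> * cis \<alpha>"] rays[of "\<delta>/2"] \<delta> by auto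
  define P N where "P = {w \<in> V. h w > 0}" and "N = {w \<in> V. - h w > 0}"
  have "connected P"
    unfolding P_def using \<open>compact V\<close> cont loc conn'(1) by (rule connected_positivity_set)
  moreover have "connected N"
    unfolding N_def
  proof (rule connected_positivity_set[OF \<open>compact V\<close> _ _ conn'(2)])
    show "continuous_on V (\<lambda>z. - h z)"
      using cont by (intro continuous_intros)
    show "locally_Re_holomorphic (\<lambda>z. - h z) (interior V)"
      using locally_Re_holomorphic_cmult[OF loc, of "-1"] by simp
  qed
  moreover have "P \<inter> closure (insert z N) = {}" "N \<inter> closure (insert z P) = {}"
  proof -
    have "closed V"
      using \<open>compact V\<close> by (rule compact_imp_closed)
    have cl: "closed {w \<in> V. h w \<in> {..0}}" "closed {w \<in> V. h w \<in> {0..}}"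
      using continuous_closed_preimage[OF cont \<open>closed V\<close>, of "{..0}"]
        continuous_closed_preimage[OF cont \<open>closed V\<close>, of "{0..}"]
      by (simp_all add: vimage_def Collect_conj_eq[symmetric] Int_def)
    have "insert z N \<subseteq> {w \<in> V. h w \<in> {..0}}" "insert z P \<subseteq> {w \<in> V. h w \<in> {0..}}"
      using zV crit(1) by (auto simp: P_def N_def)
    then have "closure (insert z N) \<subseteq> {w \<in> V. h w \<in> {..0}}" "closure (insert z P) \<subseteq> {w \<in> V. h w \<in> {0..}}"
      using closure_minimal[OF _ cl(1), of "insert z N"] closure_minimal[OF _ cl(2), of "insert z P"]
      by simp_all
    then show "P \<inter> closure (insert z N) = {}" "N \<inter> closure (insert z P) = {}"
      unfolding P_def N_def by fastforce+
  qed
  ultimately obtain P' N' where P': "open P'" "connected P'" "P \<subseteq> P'" "z \<notin> P'"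
    and N': "open N'" "connected N'" "N \<subseteq> N'" "z \<notin> N'" and disj: "P' \<inter> N' = {}"
    by (rule separated_connected_open_neighbourhoods)
  \<comment> \<open>The coordinate \<open>(w - z) / \<omega>\<close> moves \<open>z\<close> to the origin and the base direction to \<open>1\<close>.\<close>
  define S where "S X = (\<lambda>w. (w - z) / \<omega>) ` X" for X
  have S_eq: "S X = (\<lambda>\<zeta>. z + \<omega> * \<zeta>) -` X" for X
  proof -
    have "\<zeta> \<in> S X" if "z + \<omega> * \<zeta> \<in> X" for \<zeta>
      using that \<omega> unfolding S_def by (intro image_eqI[of _ _ "z + \<omega> * \<zeta>"]) auto
    then show ?thesis
      using \<omega> by (auto simp: S_def)
  qed
  have "open (S X)" "connected (S X)" if "open X" "connected X" for X
  proof -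
    show "connected (S X)"
      unfolding S_def using that \<omega> by (intro connected_continuous_image continuous_intros) auto
    show "open (S X)"
      unfolding S_eq using that by (intro open_vimage continuous_intros)
  qed
  then show False
  proof (intro no_crossing_at_origin[of "S P'" "S N'" \<alpha> \<beta> "\<delta> / 2"])
    show "S P' \<inter> S N' = {}"
      unfolding S_eq using disj by blast
    show "0 \<notin> S P'" "0 \<notin> S N'"
      unfolding S_eq using P' N' by auto
    fix t assume t: "0 < t" "t \<le> \<delta> / 2"
    have eq: "z + \<omega> * (t *\<^sub>R x) = z + of_real t * \<omega> * x" for x
      by (simp add: scaleR_conv_of_real)
    have "t *\<^sub>R x \<in> S P'" if "z + of_real t * \<omega> * x \<in> {w \<in> V. h w > 0}" for x
      unfolding S_eq vimage_eq eq using that P'(3) by (auto simp: P_def)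
    moreover have "t *\<^sub>R x \<in> S N'" if "z + of_real t * \<omega> * x \<in> {w \<in> V. h w < 0}" for x
      unfolding S_eq vimage_eq eq using that N'(3) by (auto simp: N_def)
    moreover have "t < \<delta>"
      using t \<delta> by simp
    ultimately show "t *\<^sub>R cis \<alpha> \<in> S P' \<and> t *\<^sub>R cis (-\<alpha>) \<in> S P'" "t *\<^sub>R 1 \<in> S N' \<and> t *\<^sub>R cis \<beta> \<in> S N'"
      using rays[OF t(1)] unfolding cis_zero by blast+
  qed (use P' N' \<alpha> \<beta> \<delta> in auto)
qed

section \<open>The boundary correspondence\<close>

text \<open>Central projection from \<open>w0\<close> is a homeomorphism from the frontier of \<open>W\<close> to the unit sphere and
  takes this set to an open hemisphere.\<close>
lemma connected_frontier_Int_halfspace: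
  fixes W :: "'a::euclidean_space set"
  assumes "convex W" "compact W" and w0: "w0 \<in> interior W" and "c \<noteq> 0"
  shows "connected {x \<in> frontier W. inner c x > inner c w0}"
proof -
  define \<rho> where "\<rho> x = sgn (x - w0)" for x
  have ne: "x \<noteq> w0" if "x \<in> frontier W" for x
    using that w0 by (auto simp: frontier_def)
  have "inj_on \<rho> (frontier W)"
  proof (rule inj_onI)
    have *: False if x: "x \<in> frontier W" and y: "y \<in> frontier W" and "\<rho> x = \<rho> y" and "norm (x - w0) < norm (y - w0)" for x y
    proof -
      define u where "u = norm (x - w0) / norm (y - w0)"
      have u: "0 < u" "u < 1"
        using that ne[OF x] ne[OF y] by (auto simp: u_def)
      have "x - w0 = norm (x - w0) *\<^sub>R \<rho> y"
        using \<open>\<rho> x = \<rho> y\<close> by (metis \<rho>_def sgn_div_norm scaleR_scaleR right_inverse norm_eq_zero ne[OF x] right_minus_eq scaleR_one)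
      then have "x = (1 - u) *\<^sub>R w0 + u *\<^sub>R y"
        by (simp add: u_def \<rho>_def sgn_div_norm algebra_simps divide_inverse)
      then have "x \<in> open_segment w0 y"
        using u ne[OF y] by (auto simp: in_segment)
      moreover have "open_segment w0 y \<subseteq> interior W"
        using in_interior_closure_convex_segment[OF \<open>convex W\<close> w0, of y] y by (simp add: frontier_def)
      ultimately show False
        using x by (auto simp: frontier_def)
    qed
    fix x y assume xy: "x \<in> frontier W" "y \<in> frontier W" "\<rho> x = \<rho> y"
    then have "norm (x - w0) = norm (y - w0)"
      using *[of x y] *[of y x] by fastforce
    then have "norm (x - w0) *\<^sub>R \<rho> x = norm (y - w0) *\<^sub>R \<rho> y"
      using xy by simp
    then show "x = y"
      using ne xy by (simp add: \<rho>_def sgn_div_norm)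
  qed
  moreover have "continuous_on (frontier W) \<rho>"
    unfolding \<rho>_def sgn_div_norm using ne by (intro continuous_intros) auto
  moreover have "\<rho> ` frontier W = sphere 0 1"
  proof
    show "\<rho> ` frontier W \<subseteq> sphere 0 1"
      using ne by (auto simp: \<rho>_def norm_sgn)
    show "sphere 0 1 \<subseteq> \<rho> ` frontier W"
    proof
      fix l :: 'a assume l: "l \<in> sphere 0 1"
      then obtain d where "0 < d" "w0 + d *\<^sub>R l \<in> frontier W"
        using ray_to_frontier[of W w0 l] w0 \<open>compact W\<close> compact_imp_bounded by (metis dist_0_norm mem_sphere norm_zero zero_neq_one)
      moreover have "\<rho> (w0 + d *\<^sub>R l) = l"
        using l \<open>0 < d\<close> by (simp add: \<rho>_def sgn_div_norm)
      ultimately show "l \<in> \<rho> ` frontier W"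
        by force
    qed
  qed
  moreover have "compact (frontier W)"
    using \<open>compact W\<close> by (rule compact_frontier)
  ultimately obtain q where q: "homeomorphism (frontier W) (sphere 0 1) \<rho> q"
    using homeomorphism_compact by metis
  have "{x \<in> frontier W. inner c x > inner c w0} = q ` sgn ` {y. inner c y > 0}" (is "?L = ?R")
  proof
    show "?L \<subseteq> ?R"
    proof
      fix x assume x: "x \<in> ?L"
      then have "inner c (x - w0) > 0"
        by (simp add: inner_diff_right)
      moreover have "x = q (sgn (x - w0))"
        using homeomorphism_apply1[OF q, of x] x by (simp add: \<rho>_def)
      ultimately show "x \<in> ?R"
        by blast
    qed
    show "?R \<subseteq> ?L"
    proof safe
      fix y assume y: "inner c y > 0"
      then have "sgn y \<in> sphere 0 1"
        by (auto simp: norm_sgn)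
      then show fr: "q (sgn y) \<in> frontier W"
        using q by (auto simp: homeomorphism_def)
      have "sgn (q (sgn y) - w0) = sgn y"
        using homeomorphism_apply2[OF q \<open>sgn y \<in> _\<close>] by (simp add: \<rho>_def)
      moreover have "y \<noteq> 0"
        using y by auto
      ultimately have "inner c (sgn (q (sgn y) - w0)) > 0"
        using y by (simp add: sgn_div_norm)
      then show "inner c w0 < inner c (q (sgn y))"
        by (auto simp: sgn_div_norm inner_diff_right zero_less_mult_iff)
    qed
  qed
  moreover have "connected (q ` sgn ` {y. inner c y > 0})"
  proof (intro connected_continuous_image)
    show "continuous_on (sgn ` {y. inner c y > 0}) q"
      using homeomorphism_cont2[OF q] by (rule continuous_on_subset) (auto simp: norm_sgn)
    show "continuous_on {y. inner c y > 0} sgn"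
      unfolding sgn_div_norm by (intro continuous_intros) auto
    show "connected {y. inner c y > 0}"
      by (intro convex_connected convex_halfspace_gt)
  qed
  ultimately show ?thesis by simp
qed

lemma pathstart_polygonal_path: "xs \<noteq> [] \<Longrightarrow> pathstart (polygonal_path xs) = hd xs"
  by (induction xs rule: polygonal_path.induct) auto

lemma pathfinish_polygonal_path: "xs \<noteq> [] \<Longrightarrow> pathfinish (polygonal_path xs) = last xs"
  by (induction xs rule: polygonal_path.induct) auto

lemma set_subset_path_image_polygonal_path: "set xs \<subseteq> path_image (polygonal_path xs)"
proof (induction xs rule: polygonal_path.induct)
  case (4 a b c xs)
  then show ?case
    by (auto simp: path_image_join pathstart_polygonal_path)
qed auto

text \<open>Polygonal paths through equally many points have the same breakpoints in the parameter, so
  it suffices to compare them edge by edge.\<close>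
lemma polygonal_path_transfer:
  assumes "length xs = length ys" "length xs \<ge> 2"
    and "\<And>i t. Suc i < length xs \<Longrightarrow> t \<in> {0..1} \<Longrightarrow>
      G (linepath (xs ! i) (xs ! Suc i) t) = linepath (ys ! i) (ys ! Suc i) t"
    and "t \<in> {0..1}"
  shows "G (polygonal_path xs t) = polygonal_path ys t"
  using assms
proof (induction xs arbitrary: ys t rule: polygonal_path.induct)
  case (3 a b)
  then obtain a' b' where "ys = [a', b']"
    by (metis length_0_conv length_Suc_conv)
  then show ?case
    using 3(3)[of 0 t] 3(4) by simp
next
  case (4 a b c xs)
  then obtain a' b' c' ys' where ys: "ys = a' # b' # c' # ys'"
    by (auto simp: length_Suc_conv Suc_length_conv)
  show ?case
  proof (cases "t \<le> 1/2")
    case True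
    then show ?thesis
      using 4(4)[of 0 "2 * t"] 4(5) by (simp add: ys joinpaths_def)
  next
    case False
    have "G (polygonal_path (b # c # xs) (2 * t - 1)) = polygonal_path (b' # c' # ys') (2 * t - 1)"
    proof (rule 4(1))
      show "G (linepath ((b # c # xs) ! i) ((b # c # xs) ! Suc i) s) =
          linepath ((b' # c' # ys') ! i) ((b' # c' # ys') ! Suc i) s"
        if "Suc i < length (b # c # xs)" "s \<in> {0..1}" for i s
        using 4(4)[of "Suc i" s] that by (simp add: ys)
    qed (use 4(2,5) False in \<open>auto simp: ys\<close>)
    then show ?thesis
      using False by (simp add: ys joinpaths_def)
  qed
qed auto

lemma gbc_map_vertex:
  assumes "gbc_functions V vs \<phi>" "length vs = length ws" "j < length vs"
  shows "gbc_map \<phi> ws (vs ! j) = ws ! j"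
proof -
  have "gbc_map \<phi> ws (vs ! j) = (\<Sum>i<length ws. if i = j then ws ! i else 0)"
    unfolding gbc_map_def
    using assms by (intro sum.cong) (auto simp: gbc_functions_def)
  then show ?thesis
    using assms by simp
qed

text \<open>Since the coordinates are linear on the edges, the map carries one boundary curve to the other,
  parameter by parameter.\<close>
lemma gbc_map_boundary_curve:
  assumes gbc: "gbc_functions V vs \<phi>" and len: "length vs = length ws" "length vs \<ge> 1" and "t \<in> {0..1}"
  shows "gbc_map \<phi> ws (boundary_curve vs t) = boundary_curve ws t"
  unfolding boundary_curve_def
proof (rule polygonal_path_transfer)
  fix i and s :: real assume i: "Suc i < length (vs @ [hd vs])" and s: "s \<in> {0..1}"
  define n where "n = length vs"
  have "i < n" using i by (simp add: n_def)
  have nth: "(xs @ [hd xs]) ! i = xs ! i" "(xs @ [hd xs]) ! Suc i = xs ! (Suc i mod n)" if "length xs = n" for xs :: "complex list"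
  proof -
    show "(xs @ [hd xs]) ! i = xs ! i"
      using that \<open>i < n\<close> by (simp add: nth_append)
    show "(xs @ [hd xs]) ! Suc i = xs ! (Suc i mod n)"
    proof (cases "Suc i = n")
      case True
      then show ?thesis
        using that \<open>i < n\<close> by (cases xs) (auto simp: nth_append)
    next
      case False
      then show ?thesis
        using that \<open>i < n\<close> by (simp add: nth_append)
    qed
  qed
  define a b where "a = vs ! i" and "b = vs ! (Suc i mod n)"
  have "\<phi> k (linepath a b s) = (1 - s) * \<phi> k a + s * \<phi> k b" if "k < n" for k
    using gbc that \<open>i < n\<close> s unfolding gbc_functions_def linear_on_segment_def linepath_def a_def b_def n_def by blast
  then have "gbc_map \<phi> ws (linepath a b s) = (\<Sum>k<n. ((1 - s) * \<phi> k a + s * \<phi> k b) *\<^sub>R ws ! k)"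
    unfolding gbc_map_def using len by (intro sum.cong) (auto simp: n_def)
  also have "\<dots> = (1 - s) *\<^sub>R gbc_map \<phi> ws a + s *\<^sub>R gbc_map \<phi> ws b"
    using len by (simp add: gbc_map_def n_def scaleR_sum_right sum.distrib scaleR_add_left)
  also have "\<dots> = linepath (ws ! i) (ws ! (Suc i mod n)) s"
  proof -
    have "Suc i mod n < n" using \<open>i < n\<close> by simp
    then show ?thesis
      using gbc_map_vertex[OF gbc len(1)] \<open>i < n\<close> by (simp add: a_def b_def n_def linepath_def)
  qed
  finally show "gbc_map \<phi> ws (linepath ((vs @ [hd vs]) ! i) ((vs @ [hd vs]) ! Suc i) s) =
      linepath ((ws @ [hd ws]) ! i) ((ws @ [hd ws]) ! Suc i) s"
    using len(1) nth[of vs] nth[of ws] by (simp add: a_def b_def n_def)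
qed (use assms in auto)

text \<open>Each component of the complement of the boundary curve lies either inside or outside of
  \<open>V\<close>, and the unbounded one cannot lie inside.\<close>
lemma polygon_interior_eq_inside:
  assumes "polygon V vs"
  shows "interior V = inside (path_image (boundary_curve vs))"
proof -
  define J where "J = path_image (boundary_curve vs)"
  have "vs \<noteq> []" and simple: "simple_path (boundary_curve vs)" and "compact V" "interior V \<noteq> {}" and J: "frontier V = J"
    using assms by (auto simp: polygon_def J_def)
  have loop: "pathfinish (boundary_curve vs) = pathstart (boundary_curve vs)"
    using \<open>vs \<noteq> []\<close> by (simp add: boundary_curve_def pathstart_polygonal_path pathfinish_polygonal_path)
  have conn: "connected (inside J)" "connected (outside J)" "\<not> bounded (outside J)" "inside J \<union> outside J = - J"
    using Jordan_inside_outside[OF simple loop] unfolding J_def by auto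
  have "closed V" using \<open>compact V\<close> by (rule compact_imp_closed)
  then have V: "V = interior V \<union> J" "interior V \<inter> J = {}"
    using J interior_subset[of V] by (auto simp: frontier_def)
  have clopen: "U \<subseteq> interior V \<or> U \<inter> interior V = {}" if "connected U" "U \<subseteq> - J" for U
  proof -
    have "U \<subseteq> interior V \<union> - V" "interior V \<inter> - V = {}"
      using that V by blast+
    then show ?thesis
      using connectedD[OF \<open>connected U\<close>, of "interior V" "- V"] \<open>closed V\<close> by blast
  qed
  have "bounded (interior V)"
    using \<open>compact V\<close> compact_imp_bounded bounded_subset interior_subset by metis
  then have "outside J \<inter> interior V = {}"
    using clopen[OF conn(2)] conn(3,4) bounded_subset by blast
  then have "interior V \<subseteq> inside J"
    using conn(4) V(2) by blast
  moreover have "inside J \<subseteq> interior V"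
    using clopen[OF conn(1)] conn(4) \<open>interior V \<noteq> {}\<close> \<open>interior V \<subseteq> inside J\<close> by blast
  ultimately show ?thesis
    by (simp add: J_def)
qed

lemma polygon_connected_interior:
  assumes "polygon V vs"
  shows "connected (interior V)" "frontier V \<subseteq> closure (interior V)"
proof -
  have "vs \<noteq> []" and simple: "simple_path (boundary_curve vs)"
    using assms by (auto simp: polygon_def)
  have loop: "pathfinish (boundary_curve vs) = pathstart (boundary_curve vs)"
    using \<open>vs \<noteq> []\<close> by (simp add: boundary_curve_def pathstart_polygonal_path pathfinish_polygonal_path)
  show "connected (interior V)" "frontier V \<subseteq> closure (interior V)"
    using Jordan_inside_outside[OF simple loop] assms
    by (auto simp: polygon_interior_eq_inside[OF assms] polygon_def frontier_def)
qed

section \<open>The harmonic map\<close>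

text \<open>If \<open>f'\<close> and \<open>g'\<close> are linearly independent over the reals at \<open>z\<close>, then the map \<open>(Re f, Re g)\<close>
  has an invertible derivative there.\<close>
lemma locally_injective_pair_of_real_parts:
  assumes f: "f holomorphic_on ball z r" and g: "g holomorphic_on ball z r" and "r > 0"
    and indep: "\<And>p q :: real. (p, q) \<noteq> (0, 0) \<Longrightarrow> of_real p * deriv f z + of_real q * deriv g z \<noteq> 0"
  obtains s where "s > 0" "s \<le> r" "inj_on (\<lambda>w. Complex (Re (f w)) (Re (g w))) (ball z s)"
proof -
  define L where "L w d = Complex (Re (deriv f w * d)) (Re (deriv g w * d))" for w d
  have bl: "bounded_linear (L w)" for w
    unfolding linear_conv_bounded_linear[symmetric] L_def
    by (rule linearI) (auto simp: complex_eq_iff algebra_simps)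
  have "inj (L z)"
  proof -
    have "d = 0" if "L z d = 0" for d
    proof (rule ccontr)
      assume "d \<noteq> 0"
      have re: "Re (deriv f z * d) = 0" "Re (deriv g z * d) = 0"
        using that by (auto simp: L_def complex_eq_iff)
      define s t where "s = Im (deriv f z * d)" and "t = Im (deriv g z * d)"
      have st: "deriv f z * d = \<i> * of_real s" "deriv g z * d = \<i> * of_real t"
        using re by (auto simp: s_def t_def complex_eq_iff)
      have "(of_real t * deriv f z + of_real (- s) * deriv g z) * d =
          of_real t * (deriv f z * d) - of_real s * (deriv g z * d)"
        by (simp add: algebra_simps)
      also have "\<dots> = 0"
        unfolding st by simp
      finally have "(t, - s) = (0, 0)"
        using indep[of t "- s"] \<open>d \<noteq> 0\<close> by auto
      then have "deriv f z = 0"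
        using st \<open>d \<noteq> 0\<close> by auto
      then show False
        using indep[of 1 0] by simp
    qed
    then show ?thesis
      using bl[THEN bounded_linear.linear] linear_injective_0 by blast
  qed
  then obtain k where k: "linear k" "k \<circ> L z = id"
    using bl[THEN bounded_linear.linear] linear_injective_left_inverse by blast
  show thesis
  proof (rule has_derivative_locally_injective[of z "ball z r" k L "\<lambda>w. Complex (Re (f w)) (Re (g w))"])
    show "bounded_linear k"
      using k by (simp add: linear_conv_bounded_linear)
    show "((\<lambda>w. Complex (Re (f w)) (Re (g w))) has_derivative L w) (at w)" if w: "w \<in> ball z r" for w
    proof -
      have "(f has_derivative (*) (deriv f w)) (at w)" "(g has_derivative (*) (deriv g w)) (at w)"
        using holomorphic_derivI[OF f open_ball w] holomorphic_derivI[OF g open_ball w]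
        by (simp_all add: has_field_derivative_def)
      then show ?thesis
        unfolding L_def Complex_eq by (auto intro!: derivative_eq_intros)
    qed
    show "\<exists>d>0. \<forall>w. dist z w < d \<longrightarrow> onorm (\<lambda>v. L w v - L z v) < e" if "e > 0" for e
    proof -
      have "isCont (deriv f) z" "isCont (deriv g) z"
        using holomorphic_on_imp_continuous_on[OF holomorphic_deriv[OF f open_ball]]
          holomorphic_on_imp_continuous_on[OF holomorphic_deriv[OF g open_ball]] \<open>r > 0\<close>
        by (auto simp: continuous_on_eq_continuous_at)
      then obtain d1 d2 where d: "d1 > 0" "d2 > 0"
        "\<And>w. dist w z < d1 \<Longrightarrow> dist (deriv f w) (deriv f z) < e / 4"
        "\<And>w. dist w z < d2 \<Longrightarrow> dist (deriv g w) (deriv g z) < e / 4"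
        using \<open>e > 0\<close> unfolding continuous_at_eps_delta by (metis zero_less_divide_iff zero_less_numeral)
      have "onorm (\<lambda>v. L w v - L z v) < e" if w: "dist z w < min d1 d2" for w
      proof -
        have "norm (L w v - L z v) \<le> (e / 2) * norm v" for v
        proof -
          have "L w v - L z v = Complex (Re ((deriv f w - deriv f z) * v)) (Re ((deriv g w - deriv g z) * v))"
            by (simp add: L_def complex_eq_iff algebra_simps)
          also have "norm \<dots> \<le> \<bar>Re ((deriv f w - deriv f z) * v)\<bar> + \<bar>Re ((deriv g w - deriv g z) * v)\<bar>"
            using cmod_le[of "Complex (Re ((deriv f w - deriv f z) * v)) (Re ((deriv g w - deriv g z) * v))"]
            by simp
          also have "\<dots> \<le> norm (deriv f w - deriv f z) * norm v + norm (deriv g w - deriv g z) * norm v"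
            unfolding norm_mult[symmetric] by (intro add_mono abs_Re_le_cmod)
          also have "\<dots> \<le> (e / 4) * norm v + (e / 4) * norm v"
            using d(3)[of w] d(4)[of w] w
            by (intro add_mono mult_right_mono) (auto simp: dist_commute dist_norm)
          finally show ?thesis by simp
        qed
        then have "onorm (\<lambda>v. L w v - L z v) \<le> e / 2"
          using \<open>e > 0\<close> by (intro onorm_le)
        then show ?thesis
          using \<open>e > 0\<close> by simp
      qed
      then show ?thesis
        using d by (intro exI[of _ "min d1 d2"]) auto
    qed
    fix s assume s: "s > 0" "ball z s \<subseteq> ball z r" "inj_on (\<lambda>w. Complex (Re (f w)) (Re (g w))) (ball z s)"
    have "s \<le> r"
      using s(1,2) by (simp add: ball_subset_ball_iff)
    then show thesis
      using s that by blast
  qed (use k \<open>r > 0\<close> in auto)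
qed

theorem theorem2p1:
  fixes V W :: "complex set" and vs ws :: "complex list"
    and \<phi> :: "nat \<Rightarrow> complex \<Rightarrow> real"
  assumes "polygon V vs" and "counter_clockwise V vs"
    and "polygon W ws" and "counter_clockwise W ws"
    and "length vs = length ws"
    and "harmonic_gbc_functions V vs \<phi>"
    and "convex W"
  shows "bij_betw (gbc_map \<phi> ws) V W"
proof -
  define F where "F = gbc_map \<phi> ws"
  define n where "n = length vs"
  have n: "length vs = n" "length ws = n" "n \<ge> 3"
    using assms by (auto simp: n_def polygon_def)
  have gbc: "gbc_functions V vs \<phi>"
    and harm: "\<And>i. i < n \<Longrightarrow> continuous_on V (\<phi> i)" "\<And>i. i < n \<Longrightarrow> harmonic_on (\<phi> i) (interior V)"
    using assms by (auto simp: harmonic_gbc_functions_def n_def)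
  have V: "compact V" "interior V \<noteq> {}" "frontier V = path_image (boundary_curve vs)"
    and W: "compact W" "interior W \<noteq> {}" "frontier W = path_image (boundary_curve ws)"
    and simple: "simple_path (boundary_curve vs)" "simple_path (boundary_curve ws)"
    using assms by (auto simp: polygon_def)
  have closed: "closed V" "closed W"
    using V W by (auto intro: compact_imp_closed)
  note conn_V = polygon_connected_interior(1)[OF assms(1)]
  have F_def': "F x = (\<Sum>i<n. \<phi> i x *\<^sub>R ws ! i)" for x
    by (simp add: F_def gbc_map_def n)
  have cont: "continuous_on V F"
    unfolding F_def' using harm by (intro continuous_intros) auto

  have F_curve: "F (boundary_curve vs t) = boundary_curve ws t" if "t \<in> {0..1}" for t
    unfolding F_def using gbc n that by (intro gbc_map_boundary_curve) auto
  have bij_frontier: "bij_betw F (frontier V) (frontier W)"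
  proof -
    have "F ` frontier V = frontier W"
      using F_curve unfolding V(3) W(3) path_image_def image_image by (intro image_cong) auto
    moreover have "inj_on F (frontier V)"
    proof (rule inj_onI)
      fix x y assume "x \<in> frontier V" "y \<in> frontier V" and eq: "F x = F y"
      then obtain s t where st: "s \<in> {0..1}" "t \<in> {0..1}" "x = boundary_curve vs s" "y = boundary_curve vs t"
        unfolding V(3) path_image_def by blast
      have "boundary_curve ws s = boundary_curve ws t"
        using eq F_curve st by simp
      then have "s = t \<or> s = 0 \<and> t = 1 \<or> s = 1 \<and> t = 0"
        using simple(2) st unfolding simple_path_def loop_free_def by blast
      moreover have "boundary_curve vs 0 = boundary_curve vs 1"
      proof -
        have "vs \<noteq> []" using n by auto
        then have "pathstart (boundary_curve vs) = pathfinish (boundary_curve vs)"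
          by (simp add: boundary_curve_def pathstart_polygonal_path pathfinish_polygonal_path)
        then show ?thesis
          by (simp add: pathstart_def pathfinish_def)
      qed
      ultimately show "x = y"
        using st by auto
    qed
    ultimately show ?thesis
      by (simp add: bij_betw_def)
  qed
  have F_W: "F x \<in> W" if "x \<in> V" for x
    unfolding F_def'
  proof (rule convex_sum)
    show "(\<Sum>i<n. \<phi> i x) = 1" "\<And>i. i \<in> {..<n} \<Longrightarrow> 0 \<le> \<phi> i x"
      using gbc that by (auto simp: gbc_functions_def n)
    show "ws ! i \<in> W" if "i \<in> {..<n}" for i
    proof -
      have "ws ! i \<in> path_image (boundary_curve ws)"
        unfolding boundary_curve_def using set_subset_path_image_polygonal_path[of "ws @ [hd ws]"] that n by auto
      then show ?thesis
        using W(3) closed(2) frontier_subset_closed by blast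
    qed
  qed (use assms in auto)

  have loc: "locally_Re_holomorphic (\<lambda>x. inner c (F x) - k) (interior V)" for c k
  proof -
    have "locally_Re_holomorphic (\<lambda>x. (\<Sum>i<n. inner c (ws ! i) * \<phi> i x) + (- k)) (interior V)"
      using harm(2)
      by (intro locally_Re_holomorphic_add locally_Re_holomorphic_const locally_Re_holomorphic_sum
            locally_Re_holomorphic_cmult harmonic_on_imp_locally_Re_holomorphic) auto
    moreover have "(\<lambda>x. (\<Sum>i<n. inner c (ws ! i) * \<phi> i x) + (- k)) = (\<lambda>x. inner c (F x) - k)"
      by (simp add: F_def' inner_sum_right mult.commute)
    ultimately show ?thesis by simp
  qed
  have conn: "connected {x \<in> frontier V. inner c (F x) > inner c w0}" if "w0 \<in> interior W" "c \<noteq> 0" for c w0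
  proof -
    have "compact (frontier V)"
      using V(1) by (rule compact_frontier)
    moreover have "continuous_on (frontier V) F"
      using cont closed(1) frontier_subset_closed continuous_on_subset by blast
    ultimately obtain q where q: "homeomorphism (frontier V) (frontier W) F q"
      using homeomorphism_compact[of "frontier V" F "frontier W"] bij_frontier by (auto simp: bij_betw_def)
    have "{x \<in> frontier V. inner c (F x) > inner c w0} = q ` {x \<in> frontier W. inner c x > inner c w0}"
      using q by (force simp: homeomorphism_def image_iff)
    moreover have "connected (q ` {x \<in> frontier W. inner c x > inner c w0})"
      using connected_frontier_Int_halfspace[OF assms(7) W(1) that] homeomorphism_cont2[OF q]
      by (intro connected_continuous_image) (auto intro: continuous_on_subset)
    ultimately show ?thesis by simp
  qed
  \<comment> \<open>Otherwise the frontier of \<open>W\<close> would lie on a line, yet rays from an interior point in the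
    directions \<open>c\<close> and \<open>- c\<close> both meet it.\<close>
  have not_constant: "\<exists>y\<in>interior V. inner c (F y) \<noteq> k" if c: "c \<noteq> 0" for c k
  proof (rule ccontr)
    assume "\<not> ?thesis"
    then have "interior V \<subseteq> {x \<in> V. inner c (F x) = k}"
      using interior_subset by auto
    moreover have "closed {x \<in> V. inner c (F x) = k}"
      using cont closed(1) by (intro continuous_closed_preimage_constant continuous_intros) auto
    ultimately have "closure (interior V) \<subseteq> {x \<in> V. inner c (F x) = k}"
      by (rule closure_minimal)
    then have "inner c (F v) = k" if "v \<in> frontier V" for v
      using that polygon_connected_interior(2)[OF assms(1)] by blast
    then have *: "inner c x = k" if "x \<in> frontier W" for x
    proof -
      have "x \<in> F ` frontier V"
        using that bij_betw_imp_surj_on[OF bij_frontier] by simp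
      then show ?thesis
        using \<open>\<And>v. v \<in> frontier V \<Longrightarrow> inner c (F v) = k\<close> by blast
    qed
    obtain w0 where w0: "w0 \<in> interior W" using W by blast
    have "bounded W" using W by (simp add: compact_imp_bounded)
    obtain d where d: "d > 0" "w0 + d *\<^sub>R c \<in> frontier W"
      by (rule ray_to_frontier[OF \<open>bounded W\<close> w0 c])
    have "- c \<noteq> 0" using c by simp
    obtain d' where d': "d' > 0" "w0 + d' *\<^sub>R (- c) \<in> frontier W"
      by (rule ray_to_frontier[OF \<open>bounded W\<close> w0 \<open>- c \<noteq> 0\<close>])
    have "inner c w0 + d * inner c c = k" "inner c w0 - d' * inner c c = k"
      using *[OF d(2)] *[OF d'(2)] by (simp_all add: inner_add_right inner_diff_right)
    then have "(d + d') * inner c c = 0"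
      unfolding distrib_right by linarith
    then show False
      using d d' c by simp
  qed
  \<comment> \<open>No nonzero functional of \<open>F\<close> has an interior critical point.\<close>
  have regular: "deriv f z \<noteq> 0"
    if c: "c \<noteq> 0" and f: "r > 0" "ball z r \<subseteq> interior V" "f holomorphic_on ball z r"
      "\<And>w. w \<in> ball z r \<Longrightarrow> inner c (F w) - inner c (F z) = Re (f w)" for c z r f
  proof
    assume "deriv f z = 0"
    obtain y where y: "y \<in> interior V" "inner c (F y) \<noteq> inner c (F z)"
      using not_constant[OF c] by blast
    show False
    proof (rule no_critical_zero[OF V(1) conn_V _ loc[of c "inner c (F z)"] f(1-4) _ \<open>deriv f z = 0\<close> y(1)])
      show "continuous_on V (\<lambda>x. inner c (F x) - inner c (F z))"
        using cont by (intro continuous_intros)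
      fix a b assume ab: "a \<in> V" "b \<in> V" "inner c (F a) - inner c (F z) < 0" "0 < inner c (F b) - inner c (F z)"
      \<comment> \<open>As the functional takes values on both sides of its value at \<open>F z\<close>, the line through \<open>F z\<close>
        meets the interior of \<open>W\<close>, which gives a centre for the projection.\<close>
      have meets: "\<exists>p\<in>interior W. p \<in> H" if H: "open H" "x \<in> H" "x \<in> W" for H x
      proof -
        have "x \<in> closure (interior W)"
          using convex_closure_interior[OF assms(7) W(2)] that closure_subset by blast
        then show ?thesis
          using H open_Int_closure_eq_empty[of H "interior W"] by blast
      qed
      obtain p where p: "p \<in> interior W" "inner c p < inner c (F z)"
        using meets[OF open_halfspace_lt[of c "inner c (F z)"], of "F a"] F_W ab by auto
      obtain p' where p': "p' \<in> interior W" "inner c p' > inner c (F z)"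
        using meets[OF open_halfspace_gt[of "inner c (F z)" c], of "F b"] F_W ab by auto
      have "connected (interior W)"
        using assms(7) by (intro convex_connected convex_interior)
      then obtain w0 where w0: "w0 \<in> interior W" "inner c w0 = inner c (F z)"
        using connected_ivt_hyperplane[of "interior W" p p' c "inner c (F z)"] p p' by auto
      show "connected {x \<in> frontier V. inner c (F x) - inner c (F z) > 0} \<and>
            connected {x \<in> frontier V. inner c (F x) - inner c (F z) < 0}"
        using conn[OF w0(1) c] conn[OF w0(1), of "- c"] c w0(2) by simp
    qed (use y in auto)
  qed
  have locally_inj: "\<exists>r>0. ball z r \<subseteq> interior V \<and> inj_on F (ball z r)" if z: "z \<in> interior V" for z
  proof -
    obtain r1 f where f: "r1 > 0" "ball z r1 \<subseteq> interior V" "f holomorphic_on ball z r1"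
      "\<And>w. w \<in> ball z r1 \<Longrightarrow> inner 1 (F w) - inner 1 (F z) = Re (f w)"
      using loc[of 1 "inner 1 (F z)"] z unfolding locally_Re_holomorphic_def by blast
    obtain r2 g where g: "r2 > 0" "ball z r2 \<subseteq> interior V" "g holomorphic_on ball z r2"
      "\<And>w. w \<in> ball z r2 \<Longrightarrow> inner \<i> (F w) - inner \<i> (F z) = Re (g w)"
      using loc[of \<i> "inner \<i> (F z)"] z unfolding locally_Re_holomorphic_def by blast
    define r where "r = min r1 r2"
    have r: "r > 0" "ball z r \<subseteq> interior V" "f holomorphic_on ball z r" "g holomorphic_on ball z r"
      using f g by (auto simp: r_def intro: holomorphic_on_subset)
    have fg: "Re (f w) = Re (F w) - Re (F z)" "Re (g w) = Im (F w) - Im (F z)" if "w \<in> ball z r" for w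
      using f(4)[of w] g(4)[of w] that by (auto simp: r_def inner_complex_def)
    have "of_real p * deriv f z + of_real q * deriv g z \<noteq> 0" if "(p, q) \<noteq> (0, 0)" for p q :: real
    proof -
      have "deriv (\<lambda>w. of_real p * f w + of_real q * g w) z \<noteq> 0"
      proof (rule regular[of "Complex p q"])
        show "Complex p q \<noteq> 0"
          using that by (auto simp: complex_eq_iff)
        show "(\<lambda>w. of_real p * f w + of_real q * g w) holomorphic_on ball z r"
          using r by (intro holomorphic_intros)
        show "inner (Complex p q) (F w) - inner (Complex p q) (F z) = Re (of_real p * f w + of_real q * g w)"
          if "w \<in> ball z r" for w
          by (simp add: inner_complex_def fg[OF that] algebra_simps)
      qed (use r in auto)
      moreover have "((\<lambda>w. of_real p * f w + of_real q * g w) has_field_derivative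
          of_real p * deriv f z + of_real q * deriv g z) (at z)"
        using r by (auto intro!: derivative_eq_intros holomorphic_derivI[of _ "ball z r"])
      ultimately show ?thesis
        using DERIV_imp_deriv by metis
    qed
    then obtain s where s: "s > 0" "s \<le> r" "inj_on (\<lambda>w. Complex (Re (f w)) (Re (g w))) (ball z s)"
      using locally_injective_pair_of_real_parts[OF r(3,4,1)] by blast
    have "inj_on F (ball z s)"
    proof (rule inj_onI)
      fix x y assume "x \<in> ball z s" "y \<in> ball z s" "F x = F y"
      moreover from this have "x \<in> ball z r" "y \<in> ball z r"
        using s by auto
      ultimately show "x = y"
        using inj_onD[OF s(3), of x y] fg[of x] fg[of y] by simp
    qed
    moreover have "ball z s \<subseteq> interior V"
      using s(2) r(2) by (meson order_trans subset_ball)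
    ultimately show ?thesis
      using s(1) by blast
  qed
  have F_interior: "F ` interior V \<subseteq> interior W"
  proof safe
    fix z assume "z \<in> interior V"
    then obtain r where r: "r > 0" "ball z r \<subseteq> interior V" "inj_on F (ball z r)"
      using locally_inj by blast
    have "continuous_on (ball z r) F"
      using cont r(2) interior_subset[of V] by (blast intro: continuous_on_subset)
    then have "open (F ` ball z r)"
      using r by (intro invariance_of_domain) auto
    moreover have "F ` ball z r \<subseteq> W"
      using r(2) interior_subset[of V] F_W by blast
    moreover have "F z \<in> F ` ball z r"
      using r by simp
    ultimately show "F z \<in> interior W"
      by (meson interiorI)
  qed
  have "bij_betw F (interior V) (interior W)"
  proof (rule proper_locally_injective_bij_betw_convex)
    show "continuous_on (interior V) F"
      using cont interior_subset by (rule continuous_on_subset)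
    show "convex (interior W)"
      using assms by (intro convex_interior)
    show "compact (interior V \<inter> F -` K)" if K: "compact K" "K \<subseteq> interior W" for K
    proof -
      have "x \<in> interior V" if "x \<in> V" "F x \<in> K" for x
      proof (rule ccontr)
        assume "x \<notin> interior V"
        then have "x \<in> frontier V"
          using that closed by (simp add: frontier_def)
        then have "F x \<in> frontier W"
          using bij_frontier by (auto simp: bij_betw_def)
        then show False
          using K that by (auto simp: frontier_def)
      qed
      then have "interior V \<inter> F -` K = V \<inter> F -` K"
        using interior_subset by auto
      moreover have "closed (V \<inter> F -` K)"
        by (rule continuous_closed_preimage[OF cont closed(1) compact_imp_closed[OF K(1)]])
      ultimately show ?thesis
        using V(1) by (metis Int_lower1 bounded_subset compact_eq_bounded_closed)
    qed
  qed (use V conn_V F_interior locally_inj in auto)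
  then have "bij_betw F (interior V \<union> frontier V) (interior W \<union> frontier W)"
    using bij_frontier by (rule bij_betw_combine) (auto simp: frontier_def)
  moreover have "interior V \<union> frontier V = V" "interior W \<union> frontier W = W"
    using closed interior_subset by (auto simp: frontier_def)
  ultimately show ?thesis
    by (simp add: F_def)
qed

end
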